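(* Let $V$ be a finite-dimensional complex inner product space with $\dim V>1$, let $p$ be a prime, and let $G=D_m\le S_m$ be the dihedral group of order $2m$, where $m=lp^t$ with $l$ an integer not divisible by $p$. Let $1\le h<\frac l2$ and $\phi=\hat\chi_h$. Then $V_\phi(G)$ has an o-basis if and only if $\nu_2\!\left(\frac{2h}{l}\right)<0$. Also, for each $\gamma\in\Delta$ and each $\sigma\in C$, $e^\phi_{\gamma\sigma}\ne0$ if and only if $\frac{ht_\gamma}{l}\in\mathbb{Z}$.
   Context: $D_m=\langle r,s\mid r^m=s^2=1,\ srs=r^{-1}\rangle$, regarded as a subgroup of $S_m$ in the usual way ($r=(1\,2\cdots m)$ and $s$ a reflection of the $m$-gon, e.g. $s(i)\equiv 2-i \pmod m$). $\nu_2$ is the 2-adic valuation on $\mathbb{Q}$. For $1\le h<m/2$ the irreducible character $\chi_h$ has $\chi_h(r^k)=2\cos(2\pi kh/m)$ and $\chi_h(sr^k)=0$. $\hat G$ is the set of $p$-regular elements of $G$ (order not divisible by $p$), and $\hat\chi_h=\chi_h|_{\hat G}$. $C=\langle r^{p^t}\rangle$ (cyclic of order $l$). Symmetry classes: let $\{e_1,\dots,e_k\}$ be an orthonormal basis of $V$, $k=\dim V$; $\Gamma^m_k$ is the set of sequences $\alpha=(\alpha_1,\dots,\alpha_m)$ with $1\le\alpha_i\le k$; $\alpha\sigma=(\alpha_{\sigma(1)},\dots,\alpha_{\sigma(m)})$ for $\sigma\in G$; $G_\alpha$ is the stabilizer of $\alpha$; $\Delta$ is a set of representatives of the $G$-orbits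 on $\Gamma^m_k$; for $\gamma\in\Delta$, $t_\gamma=l/|C\cap G_\gamma|$. $e_\alpha=e_{\alpha_1}\otimes\cdots\otimes e_{\alpha_m}$; $V^{\otimes m}$ has the induced inner product, for which the $e_\alpha$ are orthonormal. For $\phi:S\to\mathbb{C}$ (here $S=\hat G$), $$e^\phi_\alpha=\frac{\phi(e)}{|S|}\sum_{\sigma\in S}\phi(\sigma)e_{\alpha\sigma^{-1}},\qquad V_\phi(G)=\operatorname{span}\{e^\phi_\alpha:\alpha\in\Gamma^m_k\},$$ where $\phi(e)$ is the value at the identity. An o-basis of a subspace $W\subseteq V_\phi(G)$ is an orthogonal basis of $W$ of the form $\{e^\phi_{\alpha_1},\dots,e^\phi_{\alpha_u}\}$ with $\alpha_i\in\Gamma^m_k$; the empty set is an o-basis of the zero subspace. *)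

theory Defs
  imports
    "HOL-Algebra.Sym_Groups"
    "HOL-Algebra.Multiplicative_Group"
    "HOL-Analysis.Cartesian_Space"
    "HOL-Library.FuncSet"
    "HOL-Computational_Algebra.Primes"
begin

text \<open>
  A complex inner product space whose underlying vector space is a whole type; the inner
  product is linear in the first and conjugate-linear in the second argument.
\<close>
locale complex_inner_space = vector_space scale
  for scale :: "complex \<Rightarrow> 'v::ab_group_add \<Rightarrow> 'v" +
  fixes ip :: "'v \<Rightarrow> 'v \<Rightarrow> complex"
  assumes ip_add_left: "ip (x + y) z = ip x z + ip y z"
    and ip_scale_left: "ip (scale c x) z = c * ip x z"
    and ip_commute: "ip y x = cnj (ip x y)"
    and ip_pos: "x \<noteq> 0 \<Longrightarrow> Re (ip x x) > 0"

locale finite_dim_complex_inner_space = complex_inner_space +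
  assumes finite_dim: "\<exists>B. finite B \<and> span B = UNIV"

definition orthonormal_basis ::
    "(complex \<Rightarrow> 'v::ab_group_add \<Rightarrow> 'v) \<Rightarrow> ('v \<Rightarrow> 'v \<Rightarrow> complex) \<Rightarrow> nat \<Rightarrow> (nat \<Rightarrow> 'v) \<Rightarrow> bool"
  where "orthonormal_basis scaleV ipV k e \<longleftrightarrow>
    (\<forall>i\<in>{1..k}. \<forall>j\<in>{1..k}. ipV (e i) (e j) = (if i = j then 1 else 0)) \<and>
    module.span scaleV (e ` {1..k}) = UNIV"

text \<open>
  The inner product space \<open>(scaleW, ipW)\<close> is the \<open>m\<close>-th tensor power of \<open>(scaleV, ipV)\<close> with
  its induced inner product; \<open>tens v\<close> is the decomposable tensor
  \<open>v 1 \<otimes> \<dots> \<otimes> v m\<close>. These axioms determine the tensor power up to a unique isometry: by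
  \<open>ip_tens\<close> the linear map from the algebraic tensor power of \<open>V\<close> to \<open>W\<close> that is induced by
  the multilinear map \<open>tens\<close> preserves inner products, so it is injective, and by \<open>span_tens\<close>
  it is surjective. \<open>ip_tens\<close> also forces \<open>tens v\<close> to depend only on \<open>v 1, \<dots>, v m\<close>.
\<close>
locale tensor_power =
  V: complex_inner_space scaleV ipV + W: complex_inner_space scaleW ipW
  for scaleV :: "complex \<Rightarrow> 'v::ab_group_add \<Rightarrow> 'v" and ipV :: "'v \<Rightarrow> 'v \<Rightarrow> complex"
    and scaleW :: "complex \<Rightarrow> 'w::ab_group_add \<Rightarrow> 'w" and ipW :: "'w \<Rightarrow> 'w \<Rightarrow> complex" +
  fixes m :: nat and tens :: "(nat \<Rightarrow> 'v) \<Rightarrow> 'w"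
  assumes tens_add: "i \<in> {1..m} \<Longrightarrow> tens (v(i := x + y)) = tens (v(i := x)) + tens (v(i := y))"
    and tens_scale: "i \<in> {1..m} \<Longrightarrow> tens (v(i := scaleV c x)) = scaleW c (tens (v(i := x)))"
    and ip_tens: "ipW (tens v) (tens w) = (\<Prod>i=1..m. ipV (v i) (w i))"
    and span_tens: "W.span (range tens) = UNIV"

definition std_ip :: "complex ^ 'n \<Rightarrow> complex ^ 'n \<Rightarrow> complex"
  where "std_ip x y = (\<Sum>i\<in>UNIV. x $ i * cnj (y $ i))"

lemma complex_inner_space_std: "complex_inner_space (*s) (std_ip :: complex ^ 'n \<Rightarrow> _)"
proof
  fix x y z :: "complex ^ 'n" and c
  show "std_ip (x + y) z = std_ip x z + std_ip y z"
    by (simp add: std_ip_def sum.distrib algebra_simps)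
  show "std_ip (c *s x) z = c * std_ip x z"
    by (simp add: std_ip_def sum_distrib_left algebra_simps)
  show "std_ip y x = cnj (std_ip x y)"
    by (simp add: std_ip_def mult.commute)
  assume "x \<noteq> 0"
  then obtain i where i: "x $ i \<noteq> 0"
    by (auto simp: vec_eq_iff)
  have "Re (std_ip x x) = (\<Sum>i\<in>UNIV. (cmod (x $ i))\<^sup>2)"
    by (simp add: std_ip_def cmod_power2) (simp add: power2_eq_square)
  also have "\<dots> > 0"
    using i by (intro sum_pos2[of _ i]) auto
  finally show "Re (std_ip x x) > 0" .
qed

text \<open>Tensor powers in the above sense exist for every dimension and every exponent \<open>\<ge> 1\<close>.\<close>
lemma tensor_power_exists:
  "\<exists>tens :: (nat \<Rightarrow> complex ^ 'n) \<Rightarrow> complex ^ ('m::finite \<Rightarrow> 'n::finite).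
     tensor_power (*s) std_ip (*s) std_ip CARD('m) tens"
proof -
  obtain b :: "'m \<Rightarrow> nat" where b: "bij_betw b UNIV {1..CARD('m)}"
    using finite_same_card_bij[of "UNIV :: 'm set" "{1..CARD('m)}"] by auto
  define tens :: "(nat \<Rightarrow> complex ^ 'n) \<Rightarrow> complex ^ ('m \<Rightarrow> 'n)"
    where "tens v = (\<chi> f. \<Prod>i\<in>UNIV. v (b i) $ f i)" for v
  interpret S: complex_inner_space "(*s)" "std_ip :: complex ^ 'n \<Rightarrow> _"
    by (rule complex_inner_space_std)
  interpret T: complex_inner_space "(*s)" "std_ip :: complex ^ ('m \<Rightarrow> 'n) \<Rightarrow> _"
    by (rule complex_inner_space_std)
  have inj: "inj b" using b by (simp add: bij_betw_def)
  have upd: "tens (v(b a := x)) = (\<chi> f. x $ f a * (\<Prod>i\<in>UNIV - {a}. v (b i) $ f i))" for v a x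
  proof -
    have "(\<Prod>i\<in>UNIV. (v(b a := x)) (b i) $ f i) = x $ f a * (\<Prod>i\<in>UNIV - {a}. v (b i) $ f i)" for f
      using inj by (subst prod.remove[of _ a]) (auto intro!: prod.cong simp: inj_eq)
    then show ?thesis by (simp add: tens_def vec_eq_iff)
  qed
  have ex: "\<exists>a. i = b a" if "i \<in> {1..CARD('m)}" for i
    using that b by (auto simp: bij_betw_def)
  have "tensor_power (*s) std_ip (*s) std_ip CARD('m) tens"
  proof
    fix i v and x y :: "complex ^ 'n" assume "i \<in> {1..CARD('m)}"
    then obtain a where "i = b a" using ex by blast
    then show "tens (v(i := x + y)) = tens (v(i := x)) + tens (v(i := y))"
      by (simp add: upd vec_eq_iff algebra_simps)
  next
    fix i v c and x :: "complex ^ 'n" assume "i \<in> {1..CARD('m)}"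
    then obtain a where "i = b a" using ex by blast
    then show "tens (v(i := c *s x)) = c *s tens (v(i := x))"
      by (simp add: upd vec_eq_iff algebra_simps)
  next
    fix v w :: "nat \<Rightarrow> complex ^ 'n"
    have "std_ip (tens v) (tens w) =
        (\<Sum>f\<in>UNIV. \<Prod>i\<in>UNIV. v (b i) $ f i * cnj (w (b i) $ f i))"
      by (simp add: std_ip_def tens_def prod.distrib)
    also have "\<dots> = (\<Prod>i\<in>UNIV. std_ip (v (b i)) (w (b i)))"
      using prod_sum_PiE[of UNIV "\<lambda>_. UNIV" "\<lambda>i j. v (b i) $ j * cnj (w (b i) $ j)"]
      by (simp add: std_ip_def)
    also have "\<dots> = (\<Prod>i=1..CARD('m). std_ip (v i) (w i))"
      by (rule prod.reindex_bij_betw[OF b])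
    finally show "std_ip (tens v) (tens w) = (\<Prod>i=1..CARD('m). std_ip (v i) (w i))" .
  next
    have "axis f 1 \<in> range tens" for f :: "'m \<Rightarrow> 'n"
    proof
      have "(\<Prod>i\<in>UNIV. axis (f i) (1::complex) $ g i) = axis f 1 $ g" for g
      proof (cases "g = f")
        case False
        then obtain i where "g i \<noteq> f i" by blast
        then have "(\<Prod>i\<in>UNIV. axis (f i) (1::complex) $ g i) = 0"
          by (intro prod_zero) (auto simp: axis_def)
        with False show ?thesis by (simp add: axis_def)
      qed (simp add: axis_def)
      moreover have "Hilbert_Choice.inv b (b i) = i" for i using inj by (rule inv_f_f)
      ultimately show "axis f 1 = tens (\<lambda>j. axis (f (Hilbert_Choice.inv b j)) 1)"
        by (simp add: tens_def)
    qed simp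
    then have "cart_basis \<subseteq> range tens" by (auto simp: cart_basis_def)
    then show "vec.span (range tens) = UNIV"
      using vec.span_mono span_cart_basis by blast
  qed
  then show ?thesis by blast
qed

definition rotation :: "nat \<Rightarrow> nat \<Rightarrow> nat"
  where "rotation m i = (if i \<in> {1..m} then (if i = m then 1 else i + 1) else i)"

text \<open>The representative in \<open>{1..m}\<close> of \<open>2 - i\<close> modulo \<open>m\<close>.\<close>
definition reflection :: "nat \<Rightarrow> nat \<Rightarrow> nat"
  where "reflection m i = (if i \<in> {2..m} then m + 2 - i else i)"

definition dihedral :: "nat \<Rightarrow> (nat \<Rightarrow> nat) set"
  where "dihedral m = generate (sym_group m) {rotation m, reflection m}"

definition p_regular :: "nat \<Rightarrow> nat \<Rightarrow> (nat \<Rightarrow> nat) set \<Rightarrow> (nat \<Rightarrow> nat) set"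
  where "p_regular m p G = {\<sigma> \<in> G. \<not> p dvd group.ord (sym_group m) \<sigma>}"

text \<open>The character \<open>\<chi>\<^sub>h\<close> of \<open>D\<^sub>m\<close>, \<open>m \<ge> 3\<close>. The elements of \<open>D\<^sub>m\<close> that are not
  rotations are the reflections \<open>s r\<^sup>k\<close>, on which it vanishes.\<close>
definition chi :: "nat \<Rightarrow> nat \<Rightarrow> (nat \<Rightarrow> nat) \<Rightarrow> complex"
  where "chi m h \<sigma> =
    (if \<exists>k<m. \<sigma> = rotation m [^]\<^bsub>sym_group m\<^esub> k
     then complex_of_real (2 * cos (2 * pi *
       real (THE k. k < m \<and> \<sigma> = rotation m [^]\<^bsub>sym_group m\<^esub> k) * real h / real m))
     else 0)"

text \<open>Sequences \<open>\<alpha>\<close> are extensional functions on \<open>{1..m}\<close>. Permutations fix everything outside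
  \<open>{1..m}\<close>, so the action \<open>\<alpha>\<sigma>\<close> is the composition \<open>\<alpha> \<circ> \<sigma>\<close>.\<close>
definition seqs :: "nat \<Rightarrow> nat \<Rightarrow> (nat \<Rightarrow> nat) set"
  where "seqs m k = {1..m} \<rightarrow>\<^sub>E {1..k}"

definition seq_stabilizer :: "(nat \<Rightarrow> nat) set \<Rightarrow> (nat \<Rightarrow> nat) \<Rightarrow> (nat \<Rightarrow> nat) set"
  where "seq_stabilizer G \<alpha> = {\<sigma> \<in> G. \<alpha> \<circ> \<sigma> = \<alpha>}"

definition orbit_reps ::
    "(nat \<Rightarrow> nat) set \<Rightarrow> (nat \<Rightarrow> nat) set \<Rightarrow> (nat \<Rightarrow> nat) set \<Rightarrow> bool"
  where "orbit_reps G \<Gamma> \<Delta> \<longleftrightarrow>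
    \<Delta> \<subseteq> \<Gamma> \<and> (\<forall>\<alpha>\<in>\<Gamma>. \<exists>!\<gamma>. \<gamma> \<in> \<Delta> \<and> (\<exists>\<sigma>\<in>G. \<alpha> = \<gamma> \<circ> \<sigma>))"

text \<open>The vector \<open>e\<^sup>\<phi>\<^sub>\<alpha>\<close>. Here \<open>tens (e \<circ> \<alpha>)\<close> is the decomposable tensor
  \<open>e\<^sub>\<alpha> = e (\<alpha> 1) \<otimes> \<dots> \<otimes> e (\<alpha> m)\<close>.\<close>
definition sym_tensor ::
    "(complex \<Rightarrow> 'w::ab_group_add \<Rightarrow> 'w) \<Rightarrow> ((nat \<Rightarrow> 'v) \<Rightarrow> 'w) \<Rightarrow> (nat \<Rightarrow> 'v) \<Rightarrow> nat \<Rightarrow>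
     (nat \<Rightarrow> nat) set \<Rightarrow> ((nat \<Rightarrow> nat) \<Rightarrow> complex) \<Rightarrow> (nat \<Rightarrow> nat) \<Rightarrow> 'w"
  where "sym_tensor scaleW tens e m S \<phi> \<alpha> =
    scaleW (\<phi> \<one>\<^bsub>sym_group m\<^esub> / of_nat (card S))
      (\<Sum>\<sigma>\<in>S. scaleW (\<phi> \<sigma>) (tens (e \<circ> (\<alpha> \<circ> inv\<^bsub>sym_group m\<^esub> \<sigma>))))"

definition sym_class ::
    "(complex \<Rightarrow> 'w::ab_group_add \<Rightarrow> 'w) \<Rightarrow> ((nat \<Rightarrow> 'v) \<Rightarrow> 'w) \<Rightarrow> (nat \<Rightarrow> 'v) \<Rightarrow> nat \<Rightarrow> nat \<Rightarrow>
     (nat \<Rightarrow> nat) set \<Rightarrow> ((nat \<Rightarrow> nat) \<Rightarrow> complex) \<Rightarrow> 'w set"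
  where "sym_class scaleW tens e m k S \<phi> =
    module.span scaleW (sym_tensor scaleW tens e m S \<phi> ` seqs m k)"

text \<open>An orthogonal basis of \<open>U\<close> all of whose members belong to the given family \<open>E\<close> of
  vectors (the \<open>e\<^sup>\<phi>\<^sub>\<alpha>\<close>).\<close>
definition is_o_basis ::
    "(complex \<Rightarrow> 'w::ab_group_add \<Rightarrow> 'w) \<Rightarrow> ('w \<Rightarrow> 'w \<Rightarrow> complex) \<Rightarrow> 'w set \<Rightarrow> 'w set \<Rightarrow> 'w set \<Rightarrow> bool"
  where "is_o_basis scaleW ipW E U B \<longleftrightarrow>
    B \<subseteq> E \<and> (\<forall>x\<in>B. \<forall>y\<in>B. x \<noteq> y \<longrightarrow> ipW x y = 0) \<and>
    \<not> module.dependent scaleW B \<and> module.span scaleW B = U"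

definition has_o_basis ::
    "(complex \<Rightarrow> 'w::ab_group_add \<Rightarrow> 'w) \<Rightarrow> ('w \<Rightarrow> 'w \<Rightarrow> complex) \<Rightarrow> 'w set \<Rightarrow> 'w set \<Rightarrow> bool"
  where "has_o_basis scaleW ipW E U \<longleftrightarrow> (\<exists>B. is_o_basis scaleW ipW E U B)"

text \<open>The \<open>p\<close>-adic valuation of a nonzero rational number. At \<open>0\<close>, where the valuation is
  \<open>\<infinity>\<close>, this function returns the junk value \<open>0\<close>.\<close>
definition padic_val :: "nat \<Rightarrow> rat \<Rightarrow> int"
  where "padic_val p q =
    int (multiplicity (int p) (fst (quotient_of q))) -
    int (multiplicity (int p) (snd (quotient_of q)))"

end

theory Submission
  imports Defs
begin

text \<open>
  Write \<open>c = r ^ (p ^ t)\<close>, a rotation of order \<open>l\<close>, and \<open>\<theta> = 2 \<pi> h / l\<close>. A rotation \<open>r ^ k\<close> has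
  order prime to \<open>p\<close> exactly when \<open>p ^ t\<close> divides \<open>k\<close>, so the \<open>p\<close>-regular rotations are the powers
  of \<open>c\<close>; the reflections contribute nothing because \<open>\<chi>\<^sub>h\<close> vanishes on them. Since the cosine is
  even, the symmetrized tensor is, up to a nonzero factor, the vector
  \<open>v \<alpha> = (\<Sum>j<l. cos (\<theta> j) e\<^bsub>\<alpha> c^j\<^esub>)\<close>, and only the action of the cyclic group \<open>C\<close> generated by \<open>c\<close>
  matters.

  Everything is read off the Gram matrix of these vectors (\<open>ip_v_orbit\<close>). Vectors from different
  \<open>C\<close>-orbits are orthogonal, and within an orbit \<open>\<langle>v \<alpha>, v (\<alpha> c^d)\<rangle> = N \<alpha> cos (\<theta> d)\<close> with \<open>N\<close> constant
  on the orbit. The product formula for cosines produces a term with frequency \<open>2 \<theta>\<close>, which sums to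
  zero because \<open>0 < 2 h < l\<close>, and a sum of \<open>cos (\<theta> (d + s))\<close> over the exponents \<open>s\<close> of the stabilizer
  of \<open>\<alpha>\<close>, which form a subgroup of the integers modulo \<open>l\<close>. That sum vanishes unless the
  character \<open>s \<mapsto> exp (i \<theta> s)\<close> is trivial on the subgroup, and this means that the order of the
  stabilizer divides \<open>h\<close>: the criterion for \<open>v \<alpha> \<noteq> 0\<close> (\<open>v_nonzero_iff\<close>).

  So the nonzero vectors of one orbit lie in a plane, at the angles \<open>\<theta> d\<close>, and they span it because
  \<open>sin \<theta> \<noteq> 0\<close>. An orthogonal basis can be chosen among them if and only if some \<open>\<theta> d\<close> is a right angle
  (\<open>right_angle_imp_o_basis\<close>, \<open>o_basis_imp_right_angle\<close>). This condition is the same for every orbit,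
  and a sequence with trivial stabilizer supplies an orbit of nonzero vectors, so it is necessary.
  Finally \<open>cos (2 \<pi> h d / l) = 0\<close> says that \<open>4 h d\<close> is an odd multiple of \<open>l\<close>, which is solvable in \<open>d\<close>
  if and only if the reduced denominator of \<open>2 h / l\<close> is even (\<open>right_angle_iff_padic_val_neg\<close>).
\<close>

section \<open>Orthogonality in complex inner product spaces\<close>

context complex_inner_space
begin

lemma ip_zero_left [simp]: "ip 0 z = 0"
  using ip_add_left[of 0 0 z] by simp

lemma ip_zero_right [simp]: "ip z 0 = 0"
  using ip_commute[of 0 z] by simp

lemma ip_add_right: "ip z (x + y) = ip z x + ip z y"
  using ip_commute[of z "x + y"] ip_commute[of z x] ip_commute[of z y] by (simp add: ip_add_left)

lemma ip_scale_right: "ip z (scale c x) = cnj c * ip z x"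
  using ip_commute[of z "scale c x"] ip_commute[of z x] by (simp add: ip_scale_left)

lemma ip_diff_left: "ip (x - y) z = ip x z - ip y z"
  using ip_add_left[of "x - y" y z] by simp

lemma ip_diff_right: "ip z (x - y) = ip z x - ip z y"
  using ip_add_right[of z "x - y" y] by simp

lemma ip_sum_left: "ip (sum f A) z = (\<Sum>a\<in>A. ip (f a) z)"
  by (induction A rule: infinite_finite_induct) (simp_all add: ip_add_left)

lemma ip_sum_right: "ip z (sum f A) = (\<Sum>a\<in>A. ip z (f a))"
  by (induction A rule: infinite_finite_induct) (simp_all add: ip_add_right)

lemma ip_self_eq_0_iff [simp]: "ip x x = 0 \<longleftrightarrow> x = 0"
  using ip_pos[of x] by fastforce

lemma ip_eq_0_commute: "ip x y = 0 \<longleftrightarrow> ip y x = 0"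
  using ip_commute[of x y] by simp

lemma orthogonal_to_span:
  assumes "x \<in> span B" and "\<And>b. b \<in> B \<Longrightarrow> ip z b = 0"
  shows "ip z x = 0"
  using assms(1)
  by (induction rule: span_induct_alt) (simp_all add: ip_add_right ip_scale_right assms(2))

lemma orthogonal_nonzero_independent:
  assumes "0 \<notin> B" and orth: "\<And>x y. x \<in> B \<Longrightarrow> y \<in> B \<Longrightarrow> x \<noteq> y \<Longrightarrow> ip x y = 0"
  shows "independent B"
proof
  assume "dependent B"
  then obtain T u b where T: "finite T" "T \<subseteq> B" "(\<Sum>a\<in>T. scale (u a) a) = 0" "b \<in> T" "u b \<noteq> 0"
    unfolding dependent_explicit by blast
  have "0 = ip (\<Sum>a\<in>T. scale (u a) a) b" using T(3) by simp
  also have "\<dots> = (\<Sum>a\<in>T. if a = b then u b * ip b b else 0)"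
    unfolding ip_sum_left ip_scale_left
    using T(2,4) orth by (intro sum.cong) auto
  also have "\<dots> = u b * ip b b" using T(1,4) by simp
  finally show False using T assms(1) by auto
qed

end

section \<open>Families with a cosine Gram matrix\<close>

text \<open>
  The geometry of the problem, separated from tensors: an integer action on a finite index set, and
  vectors that are orthogonal across orbits and that behave, within an orbit, like vectors of squared
  length \<open>N\<close> in a plane at the multiples of the angle \<open>\<theta>\<close>. Where \<open>N\<close> vanishes, so do the vectors.
\<close>
locale cosine_gram = complex_inner_space scale ip
  for scale :: "complex \<Rightarrow> 'v::ab_group_add \<Rightarrow> 'v" and ip :: "'v \<Rightarrow> 'v \<Rightarrow> complex" +
  fixes act :: "int \<Rightarrow> 'a \<Rightarrow> 'a" and \<Gamma> :: "'a set" and v :: "'a \<Rightarrow> 'v"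
    and N :: "'a \<Rightarrow> real" and \<theta> :: real
  assumes finite_\<Gamma>: "finite \<Gamma>"
    and act_0: "act 0 \<alpha> = \<alpha>"
    and act_add: "act (i + j) \<alpha> = act i (act j \<alpha>)"
    and act_closed: "\<alpha> \<in> \<Gamma> \<Longrightarrow> act i \<alpha> \<in> \<Gamma>"
    and N_act: "\<alpha> \<in> \<Gamma> \<Longrightarrow> N (act i \<alpha>) = N \<alpha>"
    and gram_orbit: "\<alpha> \<in> \<Gamma> \<Longrightarrow>
      ip (v \<alpha>) (v (act d \<alpha>)) = complex_of_real (N \<alpha> * cos (\<theta> * of_int d))"
    and gram_other: "\<alpha> \<in> \<Gamma> \<Longrightarrow> \<beta> \<in> \<Gamma> \<Longrightarrow> \<beta> \<notin> range (\<lambda>d. act d \<alpha>) \<Longrightarrow> ip (v \<alpha>) (v \<beta>) = 0"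
begin

lemma gram:
  assumes "\<alpha> \<in> \<Gamma>"
  shows "ip (v (act i \<alpha>)) (v (act j \<alpha>)) = complex_of_real (N \<alpha> * cos (\<theta> * (of_int j - of_int i)))"
  using gram_orbit[of "act i \<alpha>" "j - i"] act_add[of "j - i" i \<alpha>] assms
  by (simp add: act_closed N_act)

lemma orbit_act: "range (\<lambda>i. act i (act d \<alpha>)) = range (\<lambda>i. act i \<alpha>)"
proof (intro equalityI subsetI)
  fix \<beta> assume "\<beta> \<in> range (\<lambda>i. act i \<alpha>)"
  then obtain i where "\<beta> = act i \<alpha>" by blast
  then have "\<beta> = act (i - d) (act d \<alpha>)" using act_add[of "i - d" d \<alpha>] by simp
  then show "\<beta> \<in> range (\<lambda>i. act i (act d \<alpha>))" by blast
qed (auto simp: act_add[symmetric])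

lemma v_eq_0_iff: "\<alpha> \<in> \<Gamma> \<Longrightarrow> v \<alpha> = 0 \<longleftrightarrow> N \<alpha> = 0"
  using gram_orbit[of \<alpha> 0] ip_self_eq_0_iff[of "v \<alpha>"] by (simp add: act_0)

text \<open>
  Two vectors of an orbit at a right angle span the whole orbit. If \<open>N \<alpha> \<noteq> 0\<close>, the candidate \<open>y\<close> is the
  orthogonal projection to their plane. The Gram matrix alone shows that the difference from the given
  vector is orthogonal to the orbit; as it lies in the span of the orbit, it is zero.
\<close>
lemma span_right_angle:
  assumes "\<alpha> \<in> \<Gamma>" and "cos (\<theta> * of_int i) = 0"
  shows "v (act j \<alpha>) \<in> span {v \<alpha>, v (act i \<alpha>)}"
proof -
  define y where "y = scale (cos (\<theta> * of_int j)) (v \<alpha>) +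
    scale (cos (\<theta> * (of_int j - of_int i))) (v (act i \<alpha>))"
  have y: "y \<in> span {v \<alpha>, v (act i \<alpha>)}"
    unfolding y_def by (intro span_add span_scale span_base) auto
  have sq: "sin (\<theta> * of_int i) * sin (\<theta> * of_int i) = 1"
    using sin_squared_eq[of "\<theta> * of_int i"] assms(2) by (simp add: power2_eq_square)
  have orth: "ip (v (act j \<alpha>) - y) (v (act n \<alpha>)) = 0" for n
  proof -
    have "ip (v (act j \<alpha>) - y) (v (act n \<alpha>)) = complex_of_real (N \<alpha> *
      (cos (\<theta> * (of_int n - of_int j)) - cos (\<theta> * of_int j) * cos (\<theta> * of_int n) -
       cos (\<theta> * (of_int j - of_int i)) * cos (\<theta> * (of_int n - of_int i))))"
      unfolding y_def
      using gram[OF assms(1), of 0 n] gram[OF assms(1), of j n] gram[OF assms(1), of i n]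
      by (simp add: ip_diff_left ip_add_left ip_scale_left act_0 algebra_simps)
    also have "cos (\<theta> * (of_int n - of_int j)) - cos (\<theta> * of_int j) * cos (\<theta> * of_int n) -
       cos (\<theta> * (of_int j - of_int i)) * cos (\<theta> * (of_int n - of_int i)) =
       sin (\<theta> * of_int n) * sin (\<theta> * of_int j) * (1 - sin (\<theta> * of_int i) * sin (\<theta> * of_int i))"
      by (simp add: right_diff_distrib cos_diff assms(2))
    finally show ?thesis by (simp add: sq)
  qed
  have "ip (v (act j \<alpha>) - y) y = 0"
    by (rule orthogonal_to_span[OF y]) (use orth[of 0] orth[of i] in \<open>auto simp: act_0\<close>)
  then have "ip (v (act j \<alpha>) - y) (v (act j \<alpha>) - y) = 0"
    using orth[of j] by (simp add: ip_diff_right)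
  then show ?thesis using y by simp
qed

text \<open>
  A maximal orthogonal set \<open>B\<close> of nonzero members of the family is a basis. If the vectors of an orbit
  are nonzero, then one of them is in \<open>B\<close>, as otherwise any of them could be added to \<open>B\<close>. If \<open>B\<close>
  contained only one vector of the orbit, then a vector at a right angle to it could be added.
  Hence \<open>B\<close> contains two orthogonal vectors of the orbit, and they span it.
\<close>
lemma right_angle_imp_o_basis:
  assumes d: "cos (\<theta> * of_int d) = 0"
  shows "has_o_basis scale ip (v ` \<Gamma>) (span (v ` \<Gamma>))"
proof -
  define \<B> where "\<B> = {B. B \<subseteq> v ` \<Gamma> \<and> 0 \<notin> B \<and> (\<forall>x\<in>B. \<forall>y\<in>B. x \<noteq> y \<longrightarrow> ip x y = 0)}"
  have "finite \<B>"
    unfolding \<B>_def using finite_\<Gamma>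
    by (intro finite_subset[OF _ finite_Pow_iff[THEN iffD2, of "v ` \<Gamma>"]]) auto
  moreover have "{} \<in> \<B>" by (simp add: \<B>_def)
  ultimately obtain B where B: "B \<in> \<B>" and max: "\<And>B'. B' \<in> \<B> \<Longrightarrow> B \<subseteq> B' \<Longrightarrow> B = B'"
    using finite_has_maximal[of \<B>] by auto
  have orth: "ip x y = 0" if "x \<in> B" "y \<in> B" "x \<noteq> y" for x y
    using B that by (simp add: \<B>_def)
  have extend: "v \<alpha> \<in> B" if "\<alpha> \<in> \<Gamma>" "v \<alpha> \<noteq> 0" "\<And>\<delta>. \<delta> \<in> \<Gamma> \<Longrightarrow> v \<delta> \<in> B \<Longrightarrow> ip (v \<alpha>) (v \<delta>) = 0" for \<alpha>
  proof -
    have "ip (v \<alpha>) b = 0 \<and> ip b (v \<alpha>) = 0" if "b \<in> B" for b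
      using that \<open>\<And>\<delta>. \<delta> \<in> \<Gamma> \<Longrightarrow> v \<delta> \<in> B \<Longrightarrow> ip (v \<alpha>) (v \<delta>) = 0\<close> B ip_eq_0_commute[of b "v \<alpha>"]
      by (auto simp: \<B>_def)
    then have "insert (v \<alpha>) B \<in> \<B>" using B that by (auto simp: \<B>_def)
    then show ?thesis using max[of "insert (v \<alpha>) B"] by blast
  qed
  have "v \<alpha> \<in> span B" if \<alpha>: "\<alpha> \<in> \<Gamma>" for \<alpha>
  proof (cases "N \<alpha> = 0")
    case True
    then show ?thesis using v_eq_0_iff[OF \<alpha>] span_zero by simp
  next
    case False
    have "\<exists>i. v (act i \<alpha>) \<in> B"
    proof (rule ccontr)
      assume no: "\<nexists>i. v (act i \<alpha>) \<in> B"
      have "v \<alpha> \<in> B"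
      proof (rule extend)
        fix \<delta> assume "\<delta> \<in> \<Gamma>" "v \<delta> \<in> B"
        then show "ip (v \<alpha>) (v \<delta>) = 0" using gram_other[OF \<alpha>] no by blast
      qed (use False v_eq_0_iff \<alpha> in auto)
      then show False using no act_0[of \<alpha>] by metis
    qed
    then obtain i where i: "v (act i \<alpha>) \<in> B" ..
    define \<beta> where "\<beta> = act i \<alpha>"
    have \<beta>: "\<beta> \<in> \<Gamma>" "v \<beta> \<in> B" "N \<beta> \<noteq> 0"
      using i \<alpha> act_closed N_act False by (auto simp: \<beta>_def)
    have \<alpha>\<beta>: "\<alpha> = act (- i) \<beta>" using act_add[of "- i" i \<alpha>] by (simp add: \<beta>_def act_0)
    have "\<exists>j. cos (\<theta> * of_int j) = 0 \<and> v (act j \<beta>) \<in> B"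
    proof (rule ccontr)
      assume no: "\<nexists>j. cos (\<theta> * of_int j) = 0 \<and> v (act j \<beta>) \<in> B"
      have "v (act d \<beta>) \<in> B"
      proof (rule extend)
        show "act d \<beta> \<in> \<Gamma>" using \<beta> act_closed by simp
        then show "v (act d \<beta>) \<noteq> 0" using \<beta> N_act v_eq_0_iff by simp
        fix \<delta> assume \<delta>: "\<delta> \<in> \<Gamma>" "v \<delta> \<in> B"
        show "ip (v (act d \<beta>)) (v \<delta>) = 0"
        proof (cases "\<delta> \<in> range (\<lambda>j. act j \<beta>)")
          case True
          then obtain j where j: "\<delta> = act j \<beta>" by blast
          \<comment> \<open>A vector of the orbit other than \<open>v \<beta>\<close> would be in \<open>B\<close> only at a right angle to \<open>v \<beta>\<close>.\<close>
          then have "cos (\<theta> * of_int j) \<noteq> 0" using no \<delta> by blast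
          then have "ip (v \<beta>) (v \<delta>) \<noteq> 0" using gram_orbit[OF \<beta>(1), of j] \<beta>(3) j by simp
          moreover have "v \<delta> \<noteq> v \<beta> \<Longrightarrow> ip (v \<beta>) (v \<delta>) = 0"
            using orth[OF \<beta>(2) \<delta>(2)] by metis
          ultimately have "v \<delta> = v \<beta>" by blast
          then show ?thesis using gram[OF \<beta>(1), of d 0] d by (simp add: act_0)
        next
          case False
          have "\<delta> \<notin> range (\<lambda>j. act j (act d \<beta>))"
            using False unfolding orbit_act .
          then show ?thesis using gram_other act_closed \<beta> \<delta> by blast
        qed
      qed
      then show False using no d by blast
    qed
    then obtain j where "cos (\<theta> * of_int j) = 0" "v (act j \<beta>) \<in> B" by blast
    then show ?thesis
      using span_right_angle[OF \<beta>(1), of j "- i"] \<alpha>\<beta> \<beta>(2) span_mono[of "{v \<beta>, v (act j \<beta>)}" B] by auto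
  qed
  then have "span B = span (v ` \<Gamma>)"
    using B by (intro span_eq[THEN iffD2]) (auto simp: \<B>_def intro: span_base)
  moreover have "independent B"
    by (rule orthogonal_nonzero_independent) (use B in \<open>auto simp: \<B>_def\<close>)
  ultimately have "is_o_basis scale ip (v ` \<Gamma>) (span (v ` \<Gamma>)) B"
    using B by (auto simp: is_o_basis_def \<B>_def)
  then show ?thesis unfolding has_o_basis_def by blast
qed

text \<open>
  Without right angles, an orthogonal set contains at most one vector \<open>b\<close> of each nonvanishing orbit.
  Then the component \<open>w\<close> orthogonal to \<open>b\<close> of the next vector of the orbit is orthogonal to the entire
  basis although it lies in its span, so it is zero. But its squared length is a nonzero multiple of
  \<open>(sin \<theta>)\<^sup>2\<close>.
\<close>
lemma o_basis_imp_right_angle: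
  assumes basis: "has_o_basis scale ip (v ` \<Gamma>) (span (v ` \<Gamma>))"
    and \<alpha>: "\<alpha> \<in> \<Gamma>" "N \<alpha> \<noteq> 0" and "sin \<theta> \<noteq> 0"
  shows "\<exists>d::int. cos (\<theta> * of_int d) = 0"
proof (rule ccontr)
  assume no: "\<nexists>d::int. cos (\<theta> * of_int d) = 0"
  obtain B where B: "B \<subseteq> v ` \<Gamma>" "\<And>x y. x \<in> B \<Longrightarrow> y \<in> B \<Longrightarrow> x \<noteq> y \<Longrightarrow> ip x y = 0"
    and span: "span B = span (v ` \<Gamma>)"
    using basis unfolding has_o_basis_def is_o_basis_def by blast
  have "ip (v \<alpha>) (v \<alpha>) \<noteq> 0" using v_eq_0_iff \<alpha> by simp
  moreover have "v \<alpha> \<in> span B" using span \<alpha>(1) by (auto intro: span_base)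
  ultimately obtain b where b: "b \<in> B" "ip (v \<alpha>) b \<noteq> 0" using orthogonal_to_span by blast
  then obtain \<beta> where \<beta>: "\<beta> \<in> \<Gamma>" "b = v \<beta>" using B(1) by blast
  then have N\<beta>: "N \<beta> \<noteq> 0" using b(2) v_eq_0_iff[of \<beta>] by auto
  define w where "w = v (act 1 \<beta>) - scale (cos \<theta>) (v \<beta>)"
  have w\<beta>: "ip w (v (act n \<beta>)) = of_real (N \<beta> * sin \<theta> * sin (\<theta> * of_int n))" for n
    using gram[OF \<beta>(1), of 1 n] gram[OF \<beta>(1), of 0 n]
    by (simp add: w_def ip_diff_left ip_scale_left act_0 right_diff_distrib cos_diff algebra_simps)
  have "ip w x = 0" if x: "x \<in> B" for x
  proof (cases "x = b")
    case True
    then show ?thesis using w\<beta>[of 0] \<beta> by (simp add: act_0)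
  next
    case False
    obtain \<delta> where \<delta>: "\<delta> \<in> \<Gamma>" "x = v \<delta>" using B(1) x by blast
    have "\<delta> \<noteq> act i \<beta>" for i
    proof
      assume "\<delta> = act i \<beta>"
      then have "ip b x \<noteq> 0" using gram_orbit[OF \<beta>(1), of i] N\<beta> no \<beta>(2) \<delta>(2) by simp
      then show False using B(2)[OF b(1) x] False by simp
    qed
    then have "\<delta> \<notin> range (\<lambda>i. act i \<beta>)" by blast
    moreover from this have "\<delta> \<notin> range (\<lambda>i. act i (act 1 \<beta>))" unfolding orbit_act .
    ultimately show ?thesis
      using gram_other[OF \<beta>(1) \<delta>(1)] gram_other[OF act_closed[OF \<beta>(1)] \<delta>(1)] \<delta>(2)
      by (simp add: w_def ip_diff_left ip_scale_left)
  qed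
  moreover have "v (act 1 \<beta>) \<in> span B" using span act_closed[OF \<beta>(1)] by (auto intro: span_base)
  ultimately have "ip w (v (act 1 \<beta>)) = 0" using orthogonal_to_span by blast
  then show False using w\<beta>[of 1] N\<beta> \<open>sin \<theta> \<noteq> 0\<close> by simp
qed

end

section \<open>Periodic sums\<close>

text \<open>
  Translation invariance of sums over a period is what turns sums over \<open>C\<close> into character sums. The
  reflection replaces \<open>\<sigma>\<^sup>-\<^sup>1\<close> by \<open>\<sigma>\<close> in the definition of the symmetrized tensor.
\<close>
lemma sum_periodic_reindex:
  fixes f :: "int \<Rightarrow> 'b::comm_monoid_add" and l a :: int
  assumes "l > 0" and per: "\<And>n k. f (n + l * k) = f n" and "a = 1 \<or> a = -1"
  shows "(\<Sum>j\<in>{0..<l}. f (d + a * j)) = (\<Sum>j\<in>{0..<l}. f j)"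
proof -
  have fm: "f (n mod l) = f n" for n
    using per[of "n mod l" "n div l"] by simp
  have aa: "a * a = 1" using assms(3) by auto
  have "bij_betw (\<lambda>j. (d + a * j) mod l) {0..<l} {0..<l}"
  proof (rule bij_betw_byWitness[where f' = "\<lambda>j. (a * (j - d)) mod l"])
    show "\<forall>j\<in>{0..<l}. (a * ((d + a * j) mod l - d)) mod l = j"
    proof
      fix j assume "j \<in> {0..<l}"
      have "(a * ((d + a * j) mod l - d)) mod l = (a * ((d + a * j) - d)) mod l"
        by (metis mod_diff_left_eq mod_mult_right_eq)
      also have "a * ((d + a * j) - d) = j" using aa by (simp add: mult.assoc[symmetric])
      finally show "(a * ((d + a * j) mod l - d)) mod l = j" using \<open>j \<in> _\<close> by simp
    qed
    show "\<forall>j\<in>{0..<l}. (d + a * ((a * (j - d)) mod l)) mod l = j"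
    proof
      fix j assume "j \<in> {0..<l}"
      have "(d + a * ((a * (j - d)) mod l)) mod l = (d + a * (a * (j - d))) mod l"
        by (metis mod_add_right_eq mod_mult_right_eq)
      also have "d + a * (a * (j - d)) = j" using aa by (simp add: mult.assoc[symmetric])
      finally show "(d + a * ((a * (j - d)) mod l)) mod l = j" using \<open>j \<in> _\<close> by simp
    qed
  qed (use \<open>l > 0\<close> in auto)
  then have "(\<Sum>j\<in>{0..<l}. f ((d + a * j) mod l)) = (\<Sum>j\<in>{0..<l}. f j)"
    by (rule sum.reindex_bij_betw)
  then show ?thesis by (simp add: fm)
qed

lemmas sum_periodic_shift = sum_periodic_reindex[where a = 1, simplified]
lemmas sum_periodic_reflect = sum_periodic_reindex[where a = "-1" and d = 0, simplified]

text \<open>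
  The orthogonality relation for characters of a cyclic group, in a form that also covers a character
  of a subgroup extended by zero: the shift by an element \<open>d\<close> of the subgroup multiplies the sum by \<open>c\<close>
  and leaves it unchanged.
\<close>
lemma sum_quasi_periodic_eq_0:
  fixes f :: "int \<Rightarrow> 'b::idom"
  assumes "l > 0" and "\<And>n k. f (n + l * k) = f n"
    and shift: "\<And>n. f (d + n) = c * f n" and "c \<noteq> 1"
  shows "(\<Sum>j\<in>{0..<l}. f j) = 0"
proof -
  have "(\<Sum>j\<in>{0..<l}. f j) = c * (\<Sum>j\<in>{0..<l}. f j)"
    using sum_periodic_shift[OF assms(1), of f d] assms(2) by (simp add: shift sum_distrib_left)
  then show ?thesis using \<open>c \<noteq> 1\<close> by simp
qed

lemma cis_eq_1_iff: "cis x = 1 \<longleftrightarrow> (\<exists>n::int. x = 2 * pi * of_int n)"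
proof -
  have "cis x = 1 \<longleftrightarrow> cos x = 1"
    using sin_squared_eq[of x] by (auto simp: complex_eq_iff)
  then show ?thesis by (simp add: cos_one_2pi_int mult_ac)
qed

section \<open>Cosine symmetrization over a cyclic group\<close>

text \<open>
  The action of a cyclic group of order \<open>l\<close> is given as an action of the integers in which \<open>l\<close> acts
  trivially, so that orbits and shifts need no reduction modulo \<open>l\<close>. The orthonormal vectors \<open>E \<alpha>\<close>
  stand for the basis tensors \<open>e\<^sub>\<alpha>\<close>.
\<close>
locale cosine_symmetrization = complex_inner_space scale ip
  for scale :: "complex \<Rightarrow> 'v::ab_group_add \<Rightarrow> 'v" and ip :: "'v \<Rightarrow> 'v \<Rightarrow> complex" +
  fixes act :: "int \<Rightarrow> 'a \<Rightarrow> 'a" and \<Gamma> :: "'a set" and E :: "'a \<Rightarrow> 'v"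
    and l h :: nat and K :: real
  assumes finite_\<Gamma>: "finite \<Gamma>"
    and act_0: "act 0 \<alpha> = \<alpha>"
    and act_add: "act (i + j) \<alpha> = act i (act j \<alpha>)"
    and act_l: "act (int l) \<alpha> = \<alpha>"
    and act_closed: "\<alpha> \<in> \<Gamma> \<Longrightarrow> act i \<alpha> \<in> \<Gamma>"
    and E_orthonormal: "\<alpha> \<in> \<Gamma> \<Longrightarrow> \<beta> \<in> \<Gamma> \<Longrightarrow> ip (E \<alpha>) (E \<beta>) = (if \<alpha> = \<beta> then 1 else 0)"
    and h_pos: "0 < h" and h_less: "2 * h < l" and K_nz: "K \<noteq> 0"
begin

definition \<theta> :: real where "\<theta> = 2 * pi * real h / real l"

definition v :: "'a \<Rightarrow> 'v" where
  "v \<alpha> = scale (of_real K) (\<Sum>j\<in>{0..<int l}. scale (of_real (cos (\<theta> * of_int j))) (E (act j \<alpha>)))"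

definition stab :: "'a \<Rightarrow> int set" where "stab \<alpha> = {s \<in> {0..<int l}. act s \<alpha> = \<alpha>}"

text \<open>The value of \<open>ip (v \<alpha>) (v \<alpha>)\<close> for \<open>\<alpha> \<in> \<Gamma>\<close>, by \<open>ip_v_orbit\<close> below.\<close>
definition N :: "'a \<Rightarrow> real" where
  "N \<alpha> = (if card (stab \<alpha>) dvd h then K\<^sup>2 * real l / 2 * real (card (stab \<alpha>)) else 0)"

lemma l_pos: "0 < int l"
  using h_less by simp

lemma act_period: "act (n + int l * k) \<alpha> = act n \<alpha>"
proof -
  have *: "act (n + int l * int k) \<alpha> = act n \<alpha>" for n k
  proof (induction k)
    case (Suc k)
    have "act (n + int l * int (Suc k)) \<alpha> = act (n + int l * int k) (act (int l) \<alpha>)"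
      by (simp add: act_add[symmetric] algebra_simps)
    then show ?case using Suc by (simp add: act_l)
  qed simp
  show ?thesis
  proof (cases k rule: int_cases2)
    case (nonneg k')
    then show ?thesis using * by simp
  next
    case (nonpos k')
    then show ?thesis using *[of "n + int l * k" k'] by simp
  qed
qed

lemma act_inject: "act n \<alpha> = act n \<beta> \<longleftrightarrow> \<alpha> = \<beta>"
  by (metis act_0 act_add add.left_inverse)

lemma \<theta>_l: "\<theta> * real l = 2 * pi * real h"
  using l_pos by (simp add: \<theta>_def)

lemma cis_\<theta>_period: "cis (\<theta> * (of_int n + real l * of_int k)) = cis (\<theta> * of_int n)"
proof -
  have "\<theta> * (of_int n + real l * of_int k) = \<theta> * of_int n + 2 * pi * of_int (int h * k)"
    using arg_cong[OF \<theta>_l, of "\<lambda>x. x * of_int k"] by (simp add: distrib_left mult_ac)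
  then show ?thesis by (simp only: cis_mult[symmetric]) (simp add: cis_multiple_2pi del: of_int_mult)
qed

lemma cos_\<theta>_period: "cos (\<theta> * (of_int n + real l * of_int k)) = cos (\<theta> * of_int n)"
  using cis_\<theta>_period[of n k] by (simp add: complex_eq_iff)

lemma sin_\<theta>_nz: "sin \<theta> \<noteq> 0"
proof -
  have "0 < \<theta>" "\<theta> < pi" using h_pos h_less by (simp_all add: \<theta>_def field_simps)
  then show ?thesis using sin_gt_zero by force
qed

lemma cis_\<theta>_eq_1_iff: "cis (\<theta> * of_int n) = 1 \<longleftrightarrow> int l dvd int h * n"
proof -
  have "\<theta> * of_int n = 2 * pi * of_int k \<longleftrightarrow> int h * n = int l * k" for k
  proof -
    have "\<theta> * of_int n = 2 * pi * of_int k \<longleftrightarrow> real_of_int (int h * n) = real_of_int (int l * k)"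
      using l_pos by (simp add: \<theta>_def field_simps)
    then show ?thesis by (simp only: of_int_eq_iff)
  qed
  then show ?thesis by (auto simp: cis_eq_1_iff dvd_def)
qed

lemma cis_2\<theta>_neq_1: "cis (2 * \<theta>) \<noteq> 1"
proof
  assume "cis (2 * \<theta>) = 1"
  then have "int l dvd int h * 2" using cis_\<theta>_eq_1_iff[of 2] by (simp add: mult.commute)
  then show False using h_pos h_less zdvd_imp_le[of "int l" "int h * 2"] by simp
qed

text \<open>
  The integers that fix \<open>\<alpha>\<close> form a subgroup, hence they are the multiples of the least positive one,
  \<open>q\<close>. As \<open>l\<close> is among them, there are \<open>l / q\<close> of them modulo \<open>l\<close>; so \<open>q\<close> is the length of the orbit.
\<close>
lemma stab_generator:
  obtains q where "q > 0" "int l = q * int (card (stab \<alpha>))" "\<And>s. act s \<alpha> = \<alpha> \<longleftrightarrow> q dvd s"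
proof -
  define n where "n = (LEAST n. n > 0 \<and> act (int n) \<alpha> = \<alpha>)"
  have ex: "0 < l \<and> act (int l) \<alpha> = \<alpha>" using l_pos act_l by simp
  have n: "0 < n" "act (int n) \<alpha> = \<alpha>"
    using LeastI[of "\<lambda>n. n > 0 \<and> act (int n) \<alpha> = \<alpha>", OF ex] by (auto simp: n_def)
  have mult: "act (int n * k + s) \<alpha> = act s \<alpha>" for k s
  proof -
    have *: "act (int n * int k + s) \<alpha> = act s \<alpha>" for k s
    proof (induction k)
      case (Suc k)
      have "act (int n * int (Suc k) + s) \<alpha> = act (int n * int k + s) (act (int n) \<alpha>)"
        by (simp add: act_add[symmetric] algebra_simps)
      then show ?case using Suc n by simp
    qed simp
    show ?thesis
    proof (cases k rule: int_cases2)
      case (nonneg k')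
      then show ?thesis using * by simp
    next
      case (nonpos k')
      then show ?thesis using *[of k' "int n * k + s"] by simp
    qed
  qed
  have iff: "act s \<alpha> = \<alpha> \<longleftrightarrow> int n dvd s" for s
  proof
    assume "int n dvd s"
    then show "act s \<alpha> = \<alpha>" using mult[of _ 0] act_0 by (auto simp: dvd_def)
  next
    assume "act s \<alpha> = \<alpha>"
    then have "act (s mod int n) \<alpha> = \<alpha>" using mult[of "s div int n" "s mod int n"] by simp
    moreover have "0 \<le> s mod int n" "s mod int n < int n" using n(1) by simp_all
    ultimately have "\<not> 0 < nat (s mod int n)"
      using not_less_Least[of "nat (s mod int n)" "\<lambda>n. n > 0 \<and> act (int n) \<alpha> = \<alpha>"] n_def by auto
    then show "int n dvd s" using \<open>0 \<le> s mod int n\<close> by auto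
  qed
  obtain c where c: "int l = int n * c" using iffD1[OF iff act_l] unfolding dvd_def by blast
  then have "0 < c" using l_pos n(1) by (simp add: zero_less_mult_iff)
  have "stab \<alpha> = (\<lambda>i. int n * i) ` {0..<c}"
    using n(1) by (auto simp: stab_def iff c dvd_def zero_le_mult_iff mult_less_cancel_left)
  then have "card (stab \<alpha>) = nat c" using n(1) by (simp add: card_image inj_on_def)
  then show ?thesis using that[of "int n"] n(1) iff c \<open>0 < c\<close> by simp
qed

text \<open>
  The divisibility expresses that the character \<open>s \<mapsto> exp (i \<theta> s)\<close> is trivial on the stabilizer: it
  is enough to test this on the generator \<open>q\<close>, and \<open>l = q n\<close> divides \<open>h q\<close> exactly when \<open>n\<close> divides
  \<open>h\<close>.
\<close>
lemma card_stab_dvd_h_iff: "card (stab \<alpha>) dvd h \<longleftrightarrow> (\<forall>s. act s \<alpha> = \<alpha> \<longrightarrow> cis (\<theta> * of_int s) = 1)"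
proof -
  obtain q where q: "q > 0" "int l = q * int (card (stab \<alpha>))" "\<And>s. act s \<alpha> = \<alpha> \<longleftrightarrow> q dvd s"
    using stab_generator by blast
  have "card (stab \<alpha>) dvd h \<longleftrightarrow> int (card (stab \<alpha>)) dvd int h" by (simp only: int_dvd_int_iff)
  also have "\<dots> \<longleftrightarrow> int l dvd int h * q" using q(1,2) by (simp add: mult.commute)
  also have "\<dots> \<longleftrightarrow> (\<forall>s. q dvd s \<longrightarrow> int l dvd int h * s)"
    by (metis dvd_refl dvd_trans mult_dvd_mono)
  finally show ?thesis by (simp add: q(3) cis_\<theta>_eq_1_iff)
qed

lemma sum_stab:
  fixes g :: "int \<Rightarrow> 'b::comm_monoid_add"
  shows "(\<Sum>s\<in>stab \<alpha>. g s) = (\<Sum>s\<in>{0..<int l}. if act s \<alpha> = \<alpha> then g s else 0)"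
  unfolding stab_def by (rule sum.inter_filter) simp

lemma sum_cis_stab:
  "(\<Sum>s\<in>stab \<alpha>. cis (\<theta> * of_int s)) = (if card (stab \<alpha>) dvd h then of_nat (card (stab \<alpha>)) else 0)"
proof (cases "card (stab \<alpha>) dvd h")
  case True
  then have "\<forall>s. act s \<alpha> = \<alpha> \<longrightarrow> cis (\<theta> * of_int s) = 1" by (simp only: card_stab_dvd_h_iff)
  then have "(\<Sum>s\<in>stab \<alpha>. cis (\<theta> * of_int s)) = (\<Sum>s\<in>stab \<alpha>. 1)"
    by (intro sum.cong) (auto simp: stab_def)
  then show ?thesis using True by simp
next
  case False
  then obtain d where d: "act d \<alpha> = \<alpha>" "cis (\<theta> * of_int d) \<noteq> 1"
    by (auto simp: card_stab_dvd_h_iff)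
  define f where "f s = (if act s \<alpha> = \<alpha> then cis (\<theta> * of_int s) else 0)" for s
  have "(\<Sum>s\<in>stab \<alpha>. cis (\<theta> * of_int s)) = (\<Sum>s\<in>{0..<int l}. f s)"
    unfolding f_def by (rule sum_stab)
  also have "\<dots> = 0"
  proof (rule sum_quasi_periodic_eq_0[OF l_pos _ _ d(2)])
    show "f (n + int l * k) = f n" for n k by (simp add: f_def act_period cis_\<theta>_period)
    have "act (d + n) \<alpha> = \<alpha> \<longleftrightarrow> act n \<alpha> = \<alpha>" for n
      using act_add[of n d \<alpha>] d(1) by (simp add: add.commute)
    then show "f (d + n) = cis (\<theta> * of_int d) * f n" for n
      by (simp add: f_def cis_mult distrib_left)
  qed
  finally show ?thesis using False by simp
qed

lemma sum_cos_stab: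
  "(\<Sum>s\<in>stab \<alpha>. cos (\<theta> * (of_int d + of_int s))) =
     (if card (stab \<alpha>) dvd h then real (card (stab \<alpha>)) else 0) * cos (\<theta> * of_int d)"
proof -
  have "(\<Sum>s\<in>stab \<alpha>. cos (\<theta> * (of_int d + of_int s))) =
      Re (cis (\<theta> * of_int d) * (\<Sum>s\<in>stab \<alpha>. cis (\<theta> * of_int s)))"
    by (simp add: sum_distrib_left cis_mult distrib_left)
  then show ?thesis by (simp add: sum_cis_stab)
qed

text \<open>
  The term of doubled frequency in the product formula. It vanishes because \<open>exp (2 i \<theta>) = 1\<close> would
  need \<open>l\<close> to divide \<open>2 h\<close>.
\<close>
lemma sum_cos_double: "(\<Sum>j\<in>{0..<int l}. cos (\<theta> * (of_int n + 2 * of_int j))) = 0"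
proof -
  have "(\<Sum>j\<in>{0..<int l}. cis (2 * \<theta> * of_int j)) = 0"
  proof (rule sum_quasi_periodic_eq_0[OF l_pos _ _ cis_2\<theta>_neq_1])
    show "cis (2 * \<theta> * of_int (n + int l * k)) = cis (2 * \<theta> * of_int n)" for n k
      using cis_\<theta>_period[of "2 * n" "2 * k"] by (simp add: algebra_simps)
    show "cis (2 * \<theta> * of_int (1 + n)) = cis (2 * \<theta>) * cis (2 * \<theta> * of_int n)" for n
      by (simp add: cis_mult algebra_simps)
  qed
  moreover have "(\<Sum>j\<in>{0..<int l}. cos (\<theta> * (of_int n + 2 * of_int j))) =
      Re (cis (\<theta> * of_int n) * (\<Sum>j\<in>{0..<int l}. cis (2 * \<theta> * of_int j)))"
    by (simp add: sum_distrib_left cis_mult algebra_simps)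
  ultimately show ?thesis by simp
qed

lemma ip_v:
  assumes "\<alpha> \<in> \<Gamma>" "\<beta> \<in> \<Gamma>"
  shows "ip (v \<alpha>) (v \<beta>) = of_real (K\<^sup>2 * (\<Sum>j\<in>{0..<int l}. \<Sum>i\<in>{0..<int l}.
    if act i \<alpha> = act j \<beta> then cos (\<theta> * of_int j) * cos (\<theta> * of_int i) else 0))"
proof -
  have "ip (v \<alpha>) (v \<beta>) = of_real K * (of_real K * (\<Sum>j\<in>{0..<int l}. \<Sum>i\<in>{0..<int l}.
     of_real (cos (\<theta> * of_int j)) * (of_real (cos (\<theta> * of_int i)) * ip (E (act i \<alpha>)) (E (act j \<beta>)))))"
    by (simp add: v_def ip_scale_left ip_scale_right ip_sum_left ip_sum_right sum_distrib_left mult_ac)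
  also have "\<dots> = of_real K * (of_real K * (\<Sum>j\<in>{0..<int l}. \<Sum>i\<in>{0..<int l}.
     of_real (if act i \<alpha> = act j \<beta> then cos (\<theta> * of_int j) * cos (\<theta> * of_int i) else 0)))"
    by (intro arg_cong[where f = "\<lambda>x. of_real K * (of_real K * x)"] sum.cong)
      (auto simp: E_orthonormal act_closed assms)
  finally show ?thesis by (simp add: power2_eq_square)
qed

text \<open>
  The terms \<open>i\<close>, \<open>j\<close> of the double sum in \<open>ip_v\<close> survive if \<open>i = j + d + s\<close> modulo \<open>l\<close> for some \<open>s\<close> in
  the stabilizer. For fixed \<open>s\<close>, the sum over \<open>j\<close> leaves only the part of the product of cosines that
  does not depend on \<open>j\<close>.
\<close>
lemma ip_v_orbit:
  assumes "\<alpha> \<in> \<Gamma>"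
  shows "ip (v \<alpha>) (v (act d \<alpha>)) = of_real (N \<alpha> * cos (\<theta> * of_int d))"
proof -
  have "(\<Sum>j\<in>{0..<int l}. \<Sum>i\<in>{0..<int l}.
      if act i \<alpha> = act j (act d \<alpha>) then cos (\<theta> * of_int j) * cos (\<theta> * of_int i) else 0) =
    (\<Sum>j\<in>{0..<int l}. \<Sum>s\<in>stab \<alpha>. cos (\<theta> * of_int j) * cos (\<theta> * (of_int (j + d) + of_int s)))"
  proof (rule sum.cong[OF refl])
    fix j
    define f where "f i = (if act i \<alpha> = act (j + d) \<alpha> then cos (\<theta> * of_int j) * cos (\<theta> * of_int i) else 0)" for i
    have "(\<Sum>i\<in>{0..<int l}. f i) = (\<Sum>s\<in>{0..<int l}. f ((j + d) + s))"
      by (rule sum_periodic_shift[OF l_pos, symmetric])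
        (simp add: f_def act_period cos_\<theta>_period)
    also have "\<dots> = (\<Sum>s\<in>{0..<int l}. if act s \<alpha> = \<alpha>
        then cos (\<theta> * of_int j) * cos (\<theta> * (of_int (j + d) + of_int s)) else 0)"
      by (intro sum.cong) (auto simp: f_def act_add[of "j + d"] act_inject)
    also have "\<dots> = (\<Sum>s\<in>stab \<alpha>. cos (\<theta> * of_int j) * cos (\<theta> * (of_int (j + d) + of_int s)))"
      by (rule sum_stab[symmetric])
    finally show "(\<Sum>i\<in>{0..<int l}. if act i \<alpha> = act j (act d \<alpha>)
        then cos (\<theta> * of_int j) * cos (\<theta> * of_int i) else 0) =
        (\<Sum>s\<in>stab \<alpha>. cos (\<theta> * of_int j) * cos (\<theta> * (of_int (j + d) + of_int s)))"
      by (simp add: f_def act_add)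
  qed
  also have "\<dots> = (\<Sum>j\<in>{0..<int l}. \<Sum>s\<in>stab \<alpha>.
      (cos (\<theta> * (of_int d + of_int s)) + cos (\<theta> * (of_int (d + s) + 2 * of_int j))) / 2)"
  proof (intro sum.cong refl)
    fix j s
    have "\<theta> * of_int j - \<theta> * (of_int (j + d) + of_int s) = - (\<theta> * (of_int d + of_int s))"
      and "\<theta> * of_int j + \<theta> * (of_int (j + d) + of_int s) = \<theta> * (of_int (d + s) + 2 * of_int j)"
      by (simp_all add: algebra_simps)
    then show "cos (\<theta> * of_int j) * cos (\<theta> * (of_int (j + d) + of_int s)) =
        (cos (\<theta> * (of_int d + of_int s)) + cos (\<theta> * (of_int (d + s) + 2 * of_int j))) / 2"
      by (simp only: cos_times_cos cos_minus)
  qed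
  also have "\<dots> = (\<Sum>s\<in>stab \<alpha>. \<Sum>j\<in>{0..<int l}.
      (cos (\<theta> * (of_int d + of_int s)) + cos (\<theta> * (of_int (d + s) + 2 * of_int j))) / 2)"
    by (rule sum.swap)
  also have "\<dots> = (\<Sum>s\<in>stab \<alpha>. real l / 2 * cos (\<theta> * (of_int d + of_int s)))"
    by (intro sum.cong refl)
      (simp add: sum_divide_distrib[symmetric] sum.distrib sum_cos_double del: of_int_add)
  also have "\<dots> = real l / 2 * ((if card (stab \<alpha>) dvd h then real (card (stab \<alpha>)) else 0) * cos (\<theta> * of_int d))"
    by (simp only: sum_distrib_left[symmetric] sum_cos_stab)
  finally have double_sum: "(\<Sum>j\<in>{0..<int l}. \<Sum>i\<in>{0..<int l}.
      if act i \<alpha> = act j (act d \<alpha>) then cos (\<theta> * of_int j) * cos (\<theta> * of_int i) else 0) =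
      real l / 2 * ((if card (stab \<alpha>) dvd h then real (card (stab \<alpha>)) else 0) * cos (\<theta> * of_int d))" .
  show ?thesis unfolding ip_v[OF assms act_closed[OF assms]] double_sum by (simp add: N_def)
qed

lemma stab_act: "stab (act d \<alpha>) = stab \<alpha>"
proof -
  have "act s (act d \<alpha>) = act d (act s \<alpha>)" for s by (simp add: act_add[symmetric] add.commute)
  then show ?thesis by (simp add: stab_def act_inject)
qed

sublocale cosine_gram scale ip act \<Gamma> v N \<theta>
proof
  fix \<alpha> \<beta> assume *: "\<alpha> \<in> \<Gamma>" "\<beta> \<in> \<Gamma>" "\<beta> \<notin> range (\<lambda>d. act d \<alpha>)"
  have "act i \<alpha> \<noteq> act j \<beta>" for i j
  proof
    assume "act i \<alpha> = act j \<beta>"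
    then have "act (i - j) \<alpha> = \<beta>" using act_add[of "- j" i \<alpha>] act_add[of "- j" j \<beta>] by (simp add: act_0)
    then show False using *(3) by blast
  qed
  then show "ip (v \<alpha>) (v \<beta>) = 0" using ip_v *(1,2) by simp
qed (simp_all add: finite_\<Gamma> act_0 act_add act_closed ip_v_orbit N_def stab_act)

lemma v_nonzero_iff:
  assumes "\<alpha> \<in> \<Gamma>"
  shows "v \<alpha> \<noteq> 0 \<longleftrightarrow> card (stab \<alpha>) dvd h"
proof -
  have "card (stab \<alpha>) \<noteq> 0" using stab_generator[of \<alpha>] l_pos by (metis mult_zero_right of_nat_0 less_irrefl)
  then show ?thesis using v_eq_0_iff[OF assms] K_nz l_pos by (simp add: N_def)
qed

end

section \<open>The arithmetic criterion\<close>

text \<open>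
  At most one of numerator and denominator is even, so at most one of the two multiplicities is
  nonzero.
\<close>
lemma padic_val_two_neg_iff:
  fixes q :: rat
  shows "padic_val 2 q < 0 \<longleftrightarrow> even (snd (quotient_of q))"
proof -
  obtain a b where ab: "quotient_of q = (a, b)" by fastforce
  then have b: "b > 0" and cop: "coprime a b"
    using quotient_of_denom_pos quotient_of_coprime by auto
  show ?thesis
  proof (cases "even b")
    case True
    then have "odd a" using cop by (meson coprime_common_divisor odd_one)
    then have "multiplicity 2 a = 0" by (rule not_dvd_imp_multiplicity_0)
    moreover have "multiplicity 2 b > 0" using True b by (simp add: multiplicity_gt_zero_iff)
    ultimately show ?thesis using True by (simp add: padic_val_def ab)
  next
    case False
    then have "multiplicity 2 b = 0" by (rule not_dvd_imp_multiplicity_0)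
    then show ?thesis using False by (simp add: padic_val_def ab)
  qed
qed

text \<open>
  Let \<open>a / b\<close> be \<open>2 h / l\<close> in lowest terms. A right angle means that \<open>2 d a / b\<close> is an odd integer \<open>n\<close>.
  Then \<open>b n\<close> is even, hence so is \<open>b\<close>. Conversely, if \<open>b\<close> is even then \<open>a\<close> is odd and \<open>d = b / 2\<close>
  works.
\<close>
lemma right_angle_iff_padic_val_neg:
  fixes h l :: nat
  assumes "l > 0"
  shows "(\<exists>d::int. cos (2 * pi * real h / real l * of_int d) = 0) \<longleftrightarrow>
    padic_val 2 (2 * of_nat h / of_nat l) < 0"
proof -
  obtain a b where ab: "quotient_of (2 * of_nat h / of_nat l) = (a, b)" by fastforce
  have b: "b > 0" and cop: "coprime a b"
    using ab quotient_of_denom_pos quotient_of_coprime by auto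
  have "(of_int (a * int l) :: rat) = of_int (2 * int h * b)"
    using quotient_of_div[OF ab] b assms by (simp add: field_simps)
  then have frac: "a * int l = 2 * int h * b" by (simp only: of_int_eq_iff)
  have "2 * pi * real h / real l * of_int d = of_int n * (pi / 2) \<longleftrightarrow> 4 * int h * d = n * int l" for d n
  proof -
    have "2 * pi * real h / real l * of_int d = of_int n * (pi / 2) \<longleftrightarrow>
        real_of_int (4 * int h * d) = real_of_int (n * int l)"
      using assms by (simp add: field_simps)
    then show ?thesis by (simp only: of_int_eq_iff)
  qed
  then have "(\<exists>d::int. cos (2 * pi * real h / real l * of_int d) = 0) \<longleftrightarrow>
      (\<exists>d n. odd n \<and> 4 * int h * d = n * int l)"
    by (simp add: cos_zero_iff_int)
  also have "\<dots> \<longleftrightarrow> even b"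
  proof
    assume "\<exists>d n. odd n \<and> 4 * int h * d = n * int l"
    then obtain d n where dn: "odd n" "4 * int h * d = n * int l" by blast
    have "int l * (2 * d * a) = 2 * d * (2 * int h * b)" using frac by (simp add: mult_ac)
    also have "\<dots> = int l * (b * n)" using dn(2) by (simp add: mult_ac)
    finally have "2 * d * a = b * n" using assms by simp
    then show "even b" using dn(1) by (metis dvd_triv_left even_mult_iff mult.assoc)
  next
    assume "even b"
    then have "odd a" using cop by (meson coprime_common_divisor odd_one)
    moreover have "4 * int h * (b div 2) = a * int l" using frac \<open>even b\<close> by auto
    ultimately show "\<exists>d n. odd n \<and> 4 * int h * d = n * int l" by blast
  qed
  finally show ?thesis by (simp add: padic_val_two_neg_iff ab)
qed

section \<open>Rotations and p-regular elements\<close>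

lemma carrier_sym_group: "carrier (sym_group m) = {\<sigma>. \<sigma> permutes {1..m}}"
  by (auto simp: sym_group_carrier)

lemma rotation_in_carrier: "rotation m \<in> carrier (sym_group m)"
proof -
  have "bij_betw (rotation m) {1..m} {1..m}"
    by (rule bij_betw_byWitness[where f' = "\<lambda>i. if i = 1 then m else i - 1"])
      (auto simp: rotation_def)
  then show ?thesis
    unfolding sym_group_carrier by (rule bij_imp_permutes) (auto simp: rotation_def)
qed

text \<open>
  The positions are numbered from \<open>1\<close>; after a shift to \<open>0, \<dots>, m - 1\<close> the rotation is addition modulo
  \<open>m\<close>.
\<close>
lemma rotation_pow_apply:
  assumes "i \<in> {1..m}"
  shows "(rotation m [^]\<^bsub>sym_group m\<^esub> (k::nat)) i = (i - 1 + k) mod m + 1"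
  using assms
proof (induction k arbitrary: i)
  case 0
  then have "(i - 1) mod m = i - 1" by auto
  then show ?case using 0 by (simp add: sym_group_one)
next
  case (Suc k)
  have *: "(rotation m [^]\<^bsub>sym_group m\<^esub> Suc k) i = (rotation m [^]\<^bsub>sym_group m\<^esub> k) (rotation m i)"
    by (simp add: sym_group_mult)
  show ?case
  proof (cases "i = m")
    case True
    then have "(i - 1 + Suc k) mod m = k mod m" using Suc.prems by (simp add: add.commute[of _ k])
    moreover have "rotation m i = 1" using True Suc.prems by (simp add: rotation_def)
    ultimately show ?thesis unfolding * using Suc.prems Suc.IH[of 1] by simp
  next
    case False
    then have "rotation m i = i + 1" "i + 1 \<in> {1..m}" using Suc.prems by (auto simp: rotation_def)
    then show ?thesis unfolding * using Suc.prems Suc.IH[of "i + 1"] by simp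
  qed
qed

lemma ord_rotation:
  assumes "m > 0"
  shows "group.ord (sym_group m) (rotation m) = m"
proof -
  interpret SG: group "sym_group m" by (rule sym_group_is_group)
  have "rotation m [^]\<^bsub>sym_group m\<^esub> n = \<one>\<^bsub>sym_group m\<^esub> \<longleftrightarrow> m dvd n" for n :: nat
  proof
    assume "rotation m [^]\<^bsub>sym_group m\<^esub> n = \<one>\<^bsub>sym_group m\<^esub>"
    then have "(rotation m [^]\<^bsub>sym_group m\<^esub> n) 1 = 1" by (simp add: sym_group_one)
    then show "m dvd n" using rotation_pow_apply[of 1 m n] assms by auto
  next
    assume "m dvd n"
    have "(rotation m [^]\<^bsub>sym_group m\<^esub> n) i = i" for i
    proof (cases "i \<in> {1..m}")
      case True
      have "(i - 1 + n) mod m = (i - 1) mod m" using \<open>m dvd n\<close> by (metis add.right_neutral dvd_imp_mod_0 mod_add_right_eq)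
      also have "(i - 1) mod m = i - 1" using True by auto
      finally show ?thesis using True rotation_pow_apply[OF True, of n] by simp
    next
      case False
      have "(rotation m [^]\<^bsub>sym_group m\<^esub> n) permutes {1..m}"
        using SG.nat_pow_closed[OF rotation_in_carrier] sym_group_carrier by blast
      then show ?thesis using False by (rule permutes_not_in)
    qed
    then show "rotation m [^]\<^bsub>sym_group m\<^esub> n = \<one>\<^bsub>sym_group m\<^esub>" by (auto simp: sym_group_one)
  qed
  then have "SG.ord (rotation m) dvd n \<longleftrightarrow> m dvd n" for n
    using SG.pow_eq_id[OF rotation_in_carrier] by simp
  then show ?thesis by (meson dvd_antisym dvd_refl)
qed

lemma chi_rotation_pow:
  assumes "k < m"
  shows "chi m h (rotation m [^]\<^bsub>sym_group m\<^esub> k) = of_real (2 * cos (2 * pi * real k * real h / real m))"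
proof -
  have "k' = k" if "k' < m" "rotation m [^]\<^bsub>sym_group m\<^esub> k = rotation m [^]\<^bsub>sym_group m\<^esub> k'" for k'
    using arg_cong[OF that(2), of "\<lambda>\<sigma>. \<sigma> 1"] rotation_pow_apply[of 1 m] that(1) assms by simp
  then have "(THE k'. k' < m \<and> rotation m [^]\<^bsub>sym_group m\<^esub> k = rotation m [^]\<^bsub>sym_group m\<^esub> k') = k"
    using assms by blast
  then show ?thesis using assms by (auto simp: chi_def)
qed

locale p_regular_rotations =
  fixes m l p t :: nat
  assumes prime_p: "prime p" and m_eq: "m = l * p ^ t" and p_not_dvd_l: "\<not> p dvd l"
begin

sublocale SG: group "sym_group m" by (rule sym_group_is_group)

definition c :: "nat \<Rightarrow> nat" where "c = rotation m [^]\<^bsub>sym_group m\<^esub> (p ^ t)"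

abbreviation cpow :: "int \<Rightarrow> nat \<Rightarrow> nat" where "cpow j \<equiv> c [^]\<^bsub>sym_group m\<^esub> j"

lemma l_pos: "l > 0"
  using p_not_dvd_l by (cases l) auto

lemma pt_pos: "p ^ t > 0"
  using prime_p by (simp add: prime_gt_0_nat)

lemma m_pos: "m > 0"
  using l_pos pt_pos by (simp add: m_eq)

lemma c_carrier: "c \<in> carrier (sym_group m)"
  unfolding c_def by (rule SG.nat_pow_closed[OF rotation_in_carrier])

lemma ord_c: "SG.ord c = l"
proof -
  have "p ^ t dvd m" unfolding m_eq by (rule dvd_triv_right)
  then have "p ^ t dvd SG.ord (rotation m)" by (simp only: ord_rotation[OF m_pos])
  moreover have "p ^ t \<noteq> 0" using pt_pos by (rule gr_implies_not0)
  ultimately have "SG.ord c = SG.ord (rotation m) div p ^ t"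
    unfolding c_def by (rule SG.ord_pow[OF rotation_in_carrier])
  also have "\<dots> = m div p ^ t" by (simp only: ord_rotation[OF m_pos])
  also have "\<dots> = l" using \<open>p ^ t \<noteq> 0\<close> unfolding m_eq by simp
  finally show ?thesis .
qed

lemma cpow_permutes: "cpow j permutes {1..m}"
  using SG.int_pow_closed[OF c_carrier] sym_group_carrier by blast

lemma cpow_add: "cpow (i + j) = cpow j \<circ> cpow i"
  using SG.int_pow_mult[OF c_carrier, of j i] by (simp add: sym_group_mult add.commute)

lemma cpow_nat: "cpow (int j) = rotation m [^]\<^bsub>sym_group m\<^esub> (p ^ t * j)"
  unfolding c_def int_pow_int by (rule SG.nat_pow_pow[OF rotation_in_carrier])

lemma bij_betw_cpow: "bij_betw cpow {0..<int l} (generate (sym_group m) {c})"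
proof -
  have inj: "inj_on cpow {0..<int l}"
  proof (rule inj_onI)
    fix i j assume ij: "i \<in> {0..<int l}" "j \<in> {0..<int l}" "cpow i = cpow j"
    then have "int l dvd j - i" using SG.int_pow_eq[OF c_carrier] by (simp add: ord_c)
    then show "i = j" using ij by (metis atLeastLessThan_iff mod_eq_dvd_iff mod_pos_pos_trivial)
  qed
  have "cpow j \<in> cpow ` {0..<int l}" for j
  proof
    show "cpow j = cpow (j mod int l)"
      using SG.int_pow_eq[OF c_carrier, of j "j mod int l"] mod_eq_dvd_iff[of "j mod int l" "int l" j]
      by (simp add: ord_c)
  qed (use l_pos in simp)
  then have "generate (sym_group m) {c} = cpow ` {0..<int l}"
    using SG.generate_pow[OF c_carrier] by auto
  then show ?thesis using inj by (simp add: bij_betw_def)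
qed

lemma cpow_in_p_regular: "cpow j \<in> p_regular m p (dihedral m)"
proof -
  have "generate (sym_group m) {rotation m} \<subseteq> dihedral m"
    unfolding dihedral_def by (rule SG.mono_generate) simp
  moreover have "cpow j = rotation m [^]\<^bsub>sym_group m\<^esub> (int (p ^ t) * j)"
    unfolding c_def int_pow_int[symmetric] by (rule SG.int_pow_pow[OF rotation_in_carrier])
  ultimately have "cpow j \<in> dihedral m"
    using SG.generate_pow[OF rotation_in_carrier] by blast
  moreover have "SG.ord (cpow j) dvd l"
  proof -
    have "cpow j [^]\<^bsub>sym_group m\<^esub> (int l) = cpow (j * int l)"
      by (rule SG.int_pow_pow[OF c_carrier])
    also have "\<dots> = \<one>\<^bsub>sym_group m\<^esub>" using SG.int_pow_eq_id[OF c_carrier] by (simp add: ord_c)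
    finally have "cpow j [^]\<^bsub>sym_group m\<^esub> l = \<one>\<^bsub>sym_group m\<^esub>" by (simp only: int_pow_int)
    then show ?thesis using SG.pow_eq_id[of "cpow j" l] c_carrier by simp
  qed
  ultimately show ?thesis
    using p_not_dvd_l dvd_trans by (auto simp: p_regular_def)
qed

lemma finite_p_regular: "finite (p_regular m p (dihedral m))"
proof -
  have "rotation m \<in> carrier (sym_group m)" by (rule rotation_in_carrier)
  moreover have "reflection m \<in> carrier (sym_group m)"
  proof -
    have "bij_betw (reflection m) {1..m} {1..m}"
      by (rule bij_betw_byWitness[where f' = "reflection m"]) (auto simp: reflection_def)
    then show ?thesis
      unfolding sym_group_carrier by (rule bij_imp_permutes) (auto simp: reflection_def)
  qed
  ultimately have "dihedral m \<subseteq> carrier (sym_group m)"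
    unfolding dihedral_def by (intro SG.generate_incl) simp
  moreover have "finite (carrier (sym_group m))"
    unfolding carrier_sym_group by (rule finite_permutations) simp
  ultimately show ?thesis unfolding p_regular_def by (auto intro: finite_subset)
qed

text \<open>
  A nonzero character value forces a rotation \<open>r ^ k\<close>. If its order is \<open>n\<close>, then \<open>m\<close> divides \<open>k * n\<close>;
  if \<open>p\<close> does not divide \<open>n\<close>, then the factor \<open>p ^ t\<close> of \<open>m\<close> has to divide \<open>k\<close>.
\<close>
lemma p_regular_chi_nonzero_imp_cpow:
  assumes "\<sigma> \<in> p_regular m p G" and "chi m h \<sigma> \<noteq> 0"
  shows "\<sigma> \<in> generate (sym_group m) {c}"
proof -
  have "\<exists>k<m. \<sigma> = rotation m [^]\<^bsub>sym_group m\<^esub> k"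
    by (rule ccontr) (use assms(2) in \<open>simp only: chi_def if_False simp_thms\<close>)
  then obtain k :: nat where k: "\<sigma> = rotation m [^]\<^bsub>sym_group m\<^esub> k" by blast
  define n where "n = SG.ord \<sigma>"
  have \<sigma>: "\<sigma> \<in> carrier (sym_group m)" using k rotation_in_carrier by simp
  have "\<not> p dvd n" using assms(1) by (simp add: n_def p_regular_def)
  have "rotation m [^]\<^bsub>sym_group m\<^esub> (k * n) = \<one>\<^bsub>sym_group m\<^esub>"
    using SG.pow_ord_eq_1[OF \<sigma>] by (simp add: n_def k SG.nat_pow_pow[OF rotation_in_carrier])
  then have "m dvd k * n"
    using SG.pow_eq_id[OF rotation_in_carrier] ord_rotation[OF m_pos] by simp
  then have "p ^ t dvd k * n" by (simp add: m_eq dvd_mult_left mult.commute)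
  moreover have "coprime (p ^ t) n"
    using prime_p \<open>\<not> p dvd n\<close> by (simp add: prime_imp_coprime)
  ultimately have "p ^ t dvd k" by (simp add: coprime_dvd_mult_left_iff)
  then obtain j where "k = p ^ t * j" ..
  then have "\<sigma> = cpow (int j)" using k cpow_nat by simp
  then show ?thesis using SG.generate_pow[OF c_carrier] by blast
qed

lemma chi_cpow:
  assumes "j \<in> {0..<int l}"
  shows "chi m h (cpow j) = of_real (2 * cos (2 * pi * real h / real l * of_int j))"
proof -
  obtain n where n: "j = int n" using assms nonneg_int_cases by auto
  have "p ^ t * n < m" using assms pt_pos by (simp add: n m_eq mult.commute)
  then have "chi m h (cpow j) = of_real (2 * cos (2 * pi * real (p ^ t * n) * real h / real m))"
    unfolding n cpow_nat by (rule chi_rotation_pow)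
  also have "2 * pi * real (p ^ t * n) * real h / real m = 2 * pi * real h / real l * of_int j"
    using l_pos prime_gt_0_nat[OF prime_p] by (simp add: n m_eq field_simps)
  finally show ?thesis .
qed

lemma card_inter_stabilizer:
  "card (generate (sym_group m) {c} \<inter> seq_stabilizer (dihedral m) \<gamma>) =
    card {j \<in> {0..<int l}. \<gamma> \<circ> cpow j = \<gamma>}"
proof -
  have "generate (sym_group m) {c} \<inter> seq_stabilizer (dihedral m) \<gamma> =
      cpow ` {j \<in> {0..<int l}. \<gamma> \<circ> cpow j = \<gamma>}"
    unfolding bij_betw_imp_surj_on[OF bij_betw_cpow, symmetric]
    using cpow_in_p_regular by (auto simp: seq_stabilizer_def p_regular_def)
  moreover have "inj_on cpow {j \<in> {0..<int l}. \<gamma> \<circ> cpow j = \<gamma>}"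
    using bij_betw_cpow by (auto simp: bij_betw_def intro: inj_on_subset)
  ultimately show ?thesis by (simp add: card_image)
qed

end

section \<open>Symmetry classes of tensors\<close>

lemma seqs_mem: "\<alpha> \<in> seqs m k \<Longrightarrow> i \<in> {1..m} \<Longrightarrow> \<alpha> i \<in> {1..k}"
  unfolding seqs_def by (rule PiE_mem)

lemma permuted_seq_in_seqs:
  assumes "\<alpha> \<in> seqs m k" and "\<sigma> permutes {1..m}"
  shows "\<alpha> \<circ> \<sigma> \<in> seqs m k"
proof -
  have "\<alpha> (\<sigma> i) \<in> {1..k}" if "i \<in> {1..m}" for i
    using seqs_mem[OF assms(1)] permutes_in_image[OF assms(2)] that by simp
  moreover have "\<alpha> (\<sigma> i) = undefined" if "i \<notin> {1..m}" for i
    using PiE_arb[OF assms(1)[unfolded seqs_def] that] permutes_not_in[OF assms(2) that] by simp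
  ultimately show ?thesis unfolding seqs_def by (intro PiE_I) auto
qed

lemma basis_tensors_orthonormal:
  assumes "tensor_power scaleV ipV scaleW ipW m tens" and "orthonormal_basis scaleV ipV k e"
    and \<alpha>\<beta>: "\<alpha> \<in> seqs m k" "\<beta> \<in> seqs m k"
  shows "ipW (tens (e \<circ> \<alpha>)) (tens (e \<circ> \<beta>)) = (if \<alpha> = \<beta> then 1 else 0)"
proof -
  interpret tensor_power scaleV ipV scaleW ipW m tens by fact
  have "ipW (tens (e \<circ> \<alpha>)) (tens (e \<circ> \<beta>)) = (\<Prod>i=1..m. if \<alpha> i = \<beta> i then 1 else 0)"
    unfolding ip_tens
  proof (rule prod.cong[OF refl])
    fix i assume "i \<in> {1..m}"
    then have "\<alpha> i \<in> {1..k}" "\<beta> i \<in> {1..k}" using \<alpha>\<beta> seqs_mem by blast+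
    then show "ipV ((e \<circ> \<alpha>) i) ((e \<circ> \<beta>) i) = (if \<alpha> i = \<beta> i then 1 else 0)"
      using assms(2) unfolding orthonormal_basis_def by auto
  qed
  also have "\<dots> = (if \<alpha> = \<beta> then 1 else 0)"
  proof (cases "\<alpha> = \<beta>")
    case False
    then obtain i where "i \<in> {1..m}" "\<alpha> i \<noteq> \<beta> i"
      using \<alpha>\<beta> PiE_ext unfolding seqs_def by metis
    then have "(\<Prod>i=1..m. if \<alpha> i = \<beta> i then 1 else 0 :: complex) = 0"
      by (intro prod_zero) auto
    then show ?thesis using False by simp
  qed simp
  finally show ?thesis .
qed

lemma divide_nat_in_Ints_iff:
  assumes "n > 0"
  shows "real h / real n \<in> \<int> \<longleftrightarrow> n dvd h"
  using of_int_div_of_int_in_Ints_iff[of "int h" "int n", where 'a = real] assms by simp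

theorem theorem5p1:
  fixes scaleV :: "complex \<Rightarrow> 'v::ab_group_add \<Rightarrow> 'v" and ipV :: "'v \<Rightarrow> 'v \<Rightarrow> complex"
    and scaleW :: "complex \<Rightarrow> 'w::ab_group_add \<Rightarrow> 'w" and ipW :: "'w \<Rightarrow> 'w \<Rightarrow> complex"
    and tens :: "(nat \<Rightarrow> 'v) \<Rightarrow> 'w" and e :: "nat \<Rightarrow> 'v"
    and k m l p t h :: nat and G C S :: "(nat \<Rightarrow> nat) set"
    and \<phi> :: "(nat \<Rightarrow> nat) \<Rightarrow> complex" and \<Delta> :: "(nat \<Rightarrow> nat) set"
  assumes "k = vector_space.dim scaleV UNIV"
    and "G = dihedral m"
    and "C = generate (sym_group m) {rotation m [^]\<^bsub>sym_group m\<^esub> (p ^ t)}"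
    and "S = p_regular m p G"
    and "\<phi> = restrict (chi m h) S"
    and "finite_dim_complex_inner_space scaleV ipV"
    and "k > 1"
    and "orthonormal_basis scaleV ipV k e"
    and "tensor_power scaleV ipV scaleW ipW m tens"
    and "prime p"
    and "m = l * p ^ t" and "\<not> p dvd l"
    and "1 \<le> h" and "real h < real l / 2"
    and "orbit_reps G (seqs m k) \<Delta>"
  shows "(has_o_basis scaleW ipW (sym_tensor scaleW tens e m S \<phi> ` seqs m k)
            (sym_class scaleW tens e m k S \<phi>)
          \<longleftrightarrow> padic_val 2 (2 * of_nat h / of_nat l) < 0)
       \<and> (\<forall>\<gamma>\<in>\<Delta>. \<forall>\<sigma>\<in>C.
            let t\<^sub>\<gamma> = real l / real (card (C \<inter> seq_stabilizer G \<gamma>))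
            in sym_tensor scaleW tens e m S \<phi> (\<gamma> \<circ> \<sigma>) \<noteq> 0 \<longleftrightarrow> real h * t\<^sub>\<gamma> / real l \<in> \<int>)"
proof -
  let ?e = "sym_tensor scaleW tens e m S \<phi>"
  interpret tensor_power scaleV ipV scaleW ipW m tens by fact
  interpret R: p_regular_rotations m l p t
    using assms(10-12) by unfold_locales
  have C: "C = generate (sym_group m) {R.c}" by (simp add: assms(3) R.c_def)
  have S: "S = p_regular m p (dihedral m)" by (simp add: assms(2,4))
  have fin_S: "finite S" and cpow_S: "R.cpow j \<in> S" for j
    using R.finite_p_regular R.cpow_in_p_regular by (simp_all add: S)
  then have card_S: "card S \<noteq> 0" by auto
  define act where "act j \<alpha> = \<alpha> \<circ> R.cpow j" for j and \<alpha> :: "nat \<Rightarrow> nat"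
  define E where "E \<alpha> = tens (e \<circ> \<alpha>)" for \<alpha>
  \<comment> \<open>One factor \<open>2\<close> is the value of \<open>\<phi>\<close> at the identity, the other one is that in \<open>\<chi>\<^sub>h\<close>.\<close>
  define K where "K = 4 / real (card S)"
  interpret X: cosine_symmetrization scaleW ipW act "seqs m k" E l h K
  proof
    show "finite (seqs m k)" unfolding seqs_def by (intro finite_PiE) auto
    show "act 0 \<alpha> = \<alpha>" for \<alpha> by (simp add: act_def sym_group_one)
    show "act (i + j) \<alpha> = act i (act j \<alpha>)" for i j \<alpha>
      by (simp only: act_def R.cpow_add o_assoc)
    show "act (int l) \<alpha> = \<alpha>" for \<alpha>
      using R.SG.int_pow_eq_id[OF R.c_carrier, of "int l"] by (simp add: act_def R.ord_c sym_group_one)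
    show "act i \<alpha> \<in> seqs m k" if "\<alpha> \<in> seqs m k" for i \<alpha>
      unfolding act_def by (rule permuted_seq_in_seqs[OF that R.cpow_permutes])
    show "ipW (E \<alpha>) (E \<beta>) = (if \<alpha> = \<beta> then 1 else 0)" if "\<alpha> \<in> seqs m k" "\<beta> \<in> seqs m k" for \<alpha> \<beta>
      unfolding E_def using basis_tensors_orthonormal[OF assms(9,8) that] .
  qed (use assms(13,14) card_S in \<open>auto simp: K_def\<close>)
  have \<phi>: "\<phi> (R.cpow j) = of_real (2 * cos (X.\<theta> * of_int j))" if "j \<in> {0..<int l}" for j
    using R.chi_cpow[OF that, of h] cpow_S[of j] by (simp add: assms(5) X.\<theta>_def)
  have \<phi>_one: "\<phi> \<one>\<^bsub>sym_group m\<^esub> = 2" using \<phi>[of 0] R.l_pos by simp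
  have sym_tensor_eq: "?e \<alpha> = X.v \<alpha>" for \<alpha>
  proof -
    let ?f = "\<lambda>\<sigma>. scaleW (\<phi> \<sigma>) (tens (e \<circ> (\<alpha> \<circ> inv\<^bsub>sym_group m\<^esub> \<sigma>)))"
    have "(\<Sum>\<sigma>\<in>S. ?f \<sigma>) = (\<Sum>\<sigma>\<in>C. ?f \<sigma>)"
    proof (rule sum.mono_neutral_right[OF fin_S])
      show "C \<subseteq> S"
        unfolding C S bij_betw_imp_surj_on[OF R.bij_betw_cpow, symmetric]
        by (rule image_subsetI) (rule R.cpow_in_p_regular)
      show "\<forall>\<sigma>\<in>S - C. ?f \<sigma> = 0"
        using R.p_regular_chi_nonzero_imp_cpow[of _ "dihedral m" h] by (auto simp: C S assms(5))
    qed
    also have "\<dots> = (\<Sum>j\<in>{0..<int l}. ?f (R.cpow j))"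
      unfolding C by (rule sum.reindex_bij_betw[OF R.bij_betw_cpow, symmetric])
    also have "\<dots> = (\<Sum>j\<in>{0..<int l}. scaleW (of_real (2 * cos (X.\<theta> * of_int (- j)))) (E (act (- j) \<alpha>)))"
    proof (rule sum.cong[OF refl])
      fix j assume j: "j \<in> {0..<int l}"
      have "inv\<^bsub>sym_group m\<^esub> (R.cpow j) = R.cpow (- j)"
        using R.SG.int_pow_neg[OF R.c_carrier] by simp
      then show "?f (R.cpow j) = scaleW (of_real (2 * cos (X.\<theta> * of_int (- j)))) (E (act (- j) \<alpha>))"
        unfolding \<phi>[OF j] by (simp only: E_def act_def) simp
    qed
    also have "\<dots> = (\<Sum>j\<in>{0..<int l}. scaleW (of_real (2 * cos (X.\<theta> * of_int j))) (E (act j \<alpha>)))"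
      by (rule sum_periodic_reflect[OF X.l_pos]) (simp add: X.act_period X.cos_\<theta>_period)
    also have "\<dots> = scaleW 2 (\<Sum>j\<in>{0..<int l}. scaleW (of_real (cos (X.\<theta> * of_int j))) (E (act j \<alpha>)))"
      by (simp add: W.scale_sum_right)
    finally have sum: "(\<Sum>\<sigma>\<in>S. ?f \<sigma>) =
      scaleW 2 (\<Sum>j\<in>{0..<int l}. scaleW (of_real (cos (X.\<theta> * of_int j))) (E (act j \<alpha>)))" .
    have "complex_of_real K = 2 / of_nat (card S) * 2" by (simp add: K_def)
    then show ?thesis unfolding sym_tensor_def X.v_def \<phi>_one sum by (simp only: W.scale_scale)
  qed
  have stab: "card (C \<inter> seq_stabilizer G \<gamma>) = card (X.stab \<gamma>)" for \<gamma>
    using R.card_inter_stabilizer[of \<gamma>] by (simp add: C assms(2) X.stab_def act_def)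

  \<comment> \<open>The sequence \<open>(2, 1, \<dots>, 1)\<close> has trivial stabilizer in \<open>C\<close>; it exists because \<open>k > 1\<close>.\<close>
  have "\<exists>\<alpha>\<in>seqs m k. X.N \<alpha> \<noteq> 0"
  proof
    define \<alpha> where "\<alpha> = (\<lambda>i\<in>{1..m}. if i = 1 then 2 else 1::nat)"
    show \<alpha>: "\<alpha> \<in> seqs m k" using \<open>k > 1\<close> by (auto simp: \<alpha>_def seqs_def)
    have "X.stab \<alpha> = {0}"
    proof (intro equalityI subsetI)
      fix s assume "s \<in> X.stab \<alpha>"
      then have s: "s \<in> {0..<int l}" "\<alpha> \<circ> R.cpow s = \<alpha>" by (auto simp: X.stab_def act_def)
      then obtain n where n: "s = int n" using nonneg_int_cases by auto
      then have n_less: "p ^ t * n < m" using s(1) R.pt_pos by (simp add: R.m_eq mult.commute)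
      have "R.cpow s 1 \<in> {1..m}" "\<alpha> (R.cpow s 1) = \<alpha> 1"
        using permutes_in_image[OF R.cpow_permutes[of s], of 1] R.m_pos fun_cong[OF s(2), of 1] by auto
      then have "R.cpow s 1 = 1" using R.m_pos by (auto simp: \<alpha>_def split: if_splits)
      then have "p ^ t * n = 0"
        using rotation_pow_apply[of 1 m "p ^ t * n"] R.m_pos n_less unfolding n R.cpow_nat by simp
      then show "s \<in> {0}" using prime_gt_0_nat[OF R.prime_p] n by simp
    qed (use X.l_pos X.act_0 in \<open>auto simp: X.stab_def\<close>)
    then show "X.N \<alpha> \<noteq> 0" using X.v_nonzero_iff[OF \<alpha>] X.v_eq_0_iff[OF \<alpha>] by simp
  qed
  then obtain \<alpha> where \<alpha>: "\<alpha> \<in> seqs m k" "X.N \<alpha> \<noteq> 0" by blast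
  have "?e = X.v" by (rule ext) (rule sym_tensor_eq)
  then have "has_o_basis scaleW ipW (?e ` seqs m k) (sym_class scaleW tens e m k S \<phi>) \<longleftrightarrow>
      has_o_basis scaleW ipW (X.v ` seqs m k) (W.span (X.v ` seqs m k))"
    by (simp only: sym_class_def)
  also have "\<dots> \<longleftrightarrow> (\<exists>d::int. cos (X.\<theta> * of_int d) = 0)"
  proof
    assume "has_o_basis scaleW ipW (X.v ` seqs m k) (W.span (X.v ` seqs m k))"
    then show "\<exists>d::int. cos (X.\<theta> * of_int d) = 0"
      by (rule X.o_basis_imp_right_angle[OF _ \<alpha> X.sin_\<theta>_nz])
  next
    assume "\<exists>d::int. cos (X.\<theta> * of_int d) = 0"
    then obtain d :: int where "cos (X.\<theta> * of_int d) = 0" ..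
    then show "has_o_basis scaleW ipW (X.v ` seqs m k) (W.span (X.v ` seqs m k))"
      by (rule X.right_angle_imp_o_basis)
  qed
  also have "\<dots> \<longleftrightarrow> padic_val 2 (2 * of_nat h / of_nat l) < 0"
    unfolding X.\<theta>_def by (rule right_angle_iff_padic_val_neg[OF R.l_pos])
  finally have o_basis_iff: "has_o_basis scaleW ipW (?e ` seqs m k) (sym_class scaleW tens e m k S \<phi>) \<longleftrightarrow>
      padic_val 2 (2 * of_nat h / of_nat l) < 0" .
  have nonzero_iff: "?e (\<gamma> \<circ> \<sigma>) \<noteq> 0 \<longleftrightarrow>
      real h * (real l / real (card (C \<inter> seq_stabilizer G \<gamma>))) / real l \<in> \<int>"
    if \<gamma>_\<Delta>: "\<gamma> \<in> \<Delta>" and \<sigma>_C: "\<sigma> \<in> C" for \<gamma> \<sigma>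
  proof -
    have \<gamma>: "\<gamma> \<in> seqs m k" using assms(15) \<gamma>_\<Delta> by (auto simp: orbit_reps_def)
    obtain j where j: "\<sigma> = R.cpow j"
      using \<sigma>_C unfolding C bij_betw_imp_surj_on[OF R.bij_betw_cpow, symmetric] by blast
    obtain q where "int l = q * int (card (X.stab \<gamma>))" using X.stab_generator[of \<gamma>] by metis
    then have pos: "card (X.stab \<gamma>) > 0" using R.l_pos by (cases "card (X.stab \<gamma>)") auto
    have "?e (\<gamma> \<circ> \<sigma>) \<noteq> 0 \<longleftrightarrow> card (X.stab \<gamma>) dvd h"
      using X.v_nonzero_iff[OF X.act_closed[OF \<gamma>], of j]
      by (simp add: sym_tensor_eq X.stab_act) (simp add: act_def j)
    also have "\<dots> \<longleftrightarrow> real h / real (card (X.stab \<gamma>)) \<in> \<int>"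
      by (rule divide_nat_in_Ints_iff[OF pos, symmetric])
    finally show ?thesis using R.l_pos by (simp add: stab)
  qed
  show ?thesis unfolding Let_def using o_basis_iff nonzero_iff by blast
qed

end
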